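(* Let $A(z)$ and $B(z)$ be transcendental entire functions satisfying $\lambda(A)<\rho(A)$ and $\mu(B)\neq\rho(A)$. Then every non-trivial solution $f\not\equiv 0$ of the equation $f''+A(z)f'+B(z)f=0$ satisfies $\rho(f)=\infty$.
   Context: All solutions of the equation are entire functions. For an entire function $f$ with maximum modulus $M(r,f)=\max_{|z|=r}|f(z)|$ and Nevanlinna characteristic $T(r,f)$: the order is $\rho(f)=\limsup_{r\to\infty}\frac{\log^+\log^+M(r,f)}{\log r}=\limsup_{r\to\infty}\frac{\log^+T(r,f)}{\log r}$; the lower order is $\mu(f)=\liminf_{r\to\infty}\frac{\log^+\log^+M(r,f)}{\log r}=\liminf_{r\to\infty}\frac{\log^+T(r,f)}{\log r}$; $\lambda(f)$ denotes the exponent of convergence of the zeros of $f$. *)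

theory Defs
  imports "HOL-Complex_Analysis.Complex_Analysis"
begin

definition transcendental_entire :: "(complex \<Rightarrow> complex) \<Rightarrow> bool" where
  "transcendental_entire f \<longleftrightarrow> f holomorphic_on UNIV \<and> (\<nexists>p. \<forall>z. f z = poly p z)"

definition log_plus :: "real \<Rightarrow> real" where
  "log_plus x = ln (max 1 x)"

text \<open>For continuous \<open>f\<close> and \<open>r \<ge> 0\<close> the supremum is a maximum; see \<open>max_modulus_attained\<close>.\<close>

definition max_modulus :: "real \<Rightarrow> (complex \<Rightarrow> complex) \<Rightarrow> real" where
  "max_modulus r f = (SUP z\<in>sphere 0 r. norm (f z))"

lemma max_modulus_attained:
  assumes "continuous_on (sphere 0 r) f" and "r \<ge> 0"
  shows "\<exists>z\<in>sphere 0 r. norm (f z) = max_modulus r f \<and> (\<forall>w\<in>sphere 0 r. norm (f w) \<le> norm (f z))"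
proof -
  have "compact (sphere (0::complex) r)" "sphere (0::complex) r \<noteq> {}"
    using assms(2) by auto
  moreover have "continuous_on (sphere 0 r) (\<lambda>z. norm (f z))"
    using assms(1) by (intro continuous_intros)
  ultimately obtain z where z: "z \<in> sphere 0 r" "\<forall>w\<in>sphere 0 r. norm (f w) \<le> norm (f z)"
    using continuous_attains_sup by blast
  then have "max_modulus r f = norm (f z)"
    unfolding max_modulus_def by (intro cSup_eq_maximum) auto
  with z show ?thesis by auto
qed

definition growth_order :: "(complex \<Rightarrow> complex) \<Rightarrow> ereal" where
  "growth_order f = Limsup at_top (\<lambda>r. ereal (log_plus (log_plus (max_modulus r f)) / ln r))"

definition lower_growth_order :: "(complex \<Rightarrow> complex) \<Rightarrow> ereal" where
  "lower_growth_order f = Liminf at_top (\<lambda>r. ereal (log_plus (log_plus (max_modulus r f)) / ln r))"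

text \<open>
  Infimum of the \<open>\<alpha> > 0\<close> for which the sum of \<open>\<bar>z\<bar>\<close> to the power \<open>-\<alpha>\<close>, taken over the nonzero zeros
  \<open>z\<close> of \<open>f\<close> counted with multiplicity, converges. It is \<open>\<infinity>\<close> if there is no such \<open>\<alpha>\<close>. Only
  meaningful for entire \<open>f\<close> that do not vanish identically.
\<close>

definition zeros_convergence_exponent :: "(complex \<Rightarrow> complex) \<Rightarrow> ereal" where
  "zeros_convergence_exponent f =
     Inf {ereal \<alpha> | \<alpha>. \<alpha> > 0 \<and>
       (\<lambda>z. of_int (zorder f z) * norm z powr (- \<alpha>)) summable_on {z. z \<noteq> 0 \<and> f z = 0}}"

end

theory Submission
  imports Defs
begin

text \<open>
  Suppose that \<open>f\<close> had finite order. The argument rests on two consequences of finite order. The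
  first is that the logarithmic derivatives \<open>f'/f\<close> and \<open>f''/f\<close> are bounded by a power of \<open>\<bar>z\<bar>\<close>
  outside small discs about the zeros of \<open>f\<close> and \<open>f'\<close>, and these discs are so small that arbitrarily
  large circles avoid them, and that every sector contains a ray that avoids them from some point on
  (\<open>finite_growth_second_log_derivs\<close>). Where the discs are avoided, the equation gives
  \<open>\<bar>B\<bar> \<le> \<bar>z\<bar>\<^sup>c (1 + \<bar>A\<bar>)\<close>. The second is that the equation
  represents \<open>A\<close> as a quotient of functions whose growth is under control.

  On the good circles the inequality says at once that the lower order of \<open>B\<close> is at most the order of
  \<open>A\<close> (\<open>lower_growth_order_le_growth_order\<close>). Since the two differ by assumption, there are
  \<open>\<sigma> < \<rho>(A)\<close> and arbitrarily large circles on which \<open>\<bar>B\<bar> \<le> exp (r\<^sup>\<sigma>)\<close>.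

  Choose \<open>\<alpha>\<close> with \<open>\<lambda>(A) < \<alpha> < \<rho>(A)\<close>. The canonical product over the zeros of \<open>A\<close> grows at most like
  \<open>exp (C \<bar>z\<bar>\<^sup>\<alpha>)\<close>, so \<open>A = v e\<^sup>g\<close> with \<open>v\<close> of growth below \<open>\<rho>(A)\<close> and \<open>g\<close> entire
  (\<open>zeros_convergence_factorization\<close>). Here \<open>\<rho>(A)\<close> may still be infinite. But the equation reads
  \<open>(v f') e\<^sup>g = - (f'' + B f)\<close>: on the circles above, both \<open>v f'\<close> and the right-hand side are
  bounded by the exponential of a power of \<open>r\<close>. Up to a constant factor in the radius the same holds
  for their zero-free quotient \<open>e\<^sup>g\<close>, and therefore \<open>g\<close> is a polynomial \<open>p\<close>
  (\<open>coefficient_exponent_is_poly\<close>). Because \<open>\<alpha> < \<rho>(A)\<close>, its degree \<open>n\<close> satisfies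
  \<open>\<alpha> < n\<close> and \<open>\<rho>(A) \<le> n\<close>, so that \<open>\<sigma> < n\<close>.

  In the \<open>n\<close> sectors in which the leading term of \<open>p\<close> has negative real part, \<open>A\<close> tends to \<open>0\<close> along
  every ray, so on good rays there \<open>\<bar>B\<bar> \<le> 2 \<bar>z\<bar>\<^sup>c\<close> for large \<open>\<bar>z\<bar>\<close>. The complementary sectors
  have opening \<open>\<pi>/n\<close>. As \<open>\<sigma> < n\<close>, the theorem of Phragmen and Lindelof, for which a growth bound on a sequence of circles is enough,
  carries the power bound over to all of the plane (\<open>entire_bounded_on_good_rays_imp_poly\<close>). Thus
  \<open>B\<close> is a polynomial, which contradicts its transcendence.
\<close>

section \<open>Zeros of an entire function in a disc\<close>

lemma holomorphic_log_ex:
  assumes "open S" "convex S" "f holomorphic_on S" "\<And>z. z \<in> S \<Longrightarrow> f z \<noteq> 0"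
  obtains g where "g holomorphic_on S" "\<And>z. z \<in> S \<Longrightarrow> f z = exp (g z)"
proof -
  have "simply_connected S"
    using assms(2) by (rule convex_imp_simply_connected)
  then have "\<exists>g. g holomorphic_on S \<and> (\<forall>z \<in> S. f z = exp(g z))"
    using simply_connected_eq_holomorphic_log[OF assms(1)] assms(3,4) by blast
  with that show thesis by blast
qed

text \<open>
  Schwarz's lemma for the composition of \<open>g\<close> with the map \<open>x \<mapsto> x / (2 L - x)\<close>, which takes the half
  plane \<open>Re x < L\<close> into the unit disc and fixes \<open>0\<close>.
\<close>

lemma Borel_Caratheodory_half:
  assumes hol: "g holomorphic_on ball w R" and "R > 0" and gw: "g w = 0"
    and Re: "\<And>z. z \<in> ball w R \<Longrightarrow> Re (g z) < L"
    and z: "z \<in> ball w (R/2)"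
  shows "norm (g z) \<le> 2 * L"
proof -
  have L: "L > 0"
    using Re[of w] gw \<open>R > 0\<close> by simp
  have inb: "w + of_real R * u \<in> ball w R" if "norm u < 1" for u :: complex
    using that \<open>R > 0\<close> by (simp add: dist_norm norm_mult)
  define k where "k = (\<lambda>u. g (w + of_real R * u))"
  have Rek: "Re (k u) < L" if "norm u < 1" for u
    unfolding k_def by (rule Re[OF inb[OF that]])
  have kh: "k holomorphic_on ball 0 1"
    unfolding k_def
    by (rule holomorphic_on_compose_gen[OF _ hol, unfolded o_def])
       (auto intro!: holomorphic_intros inb simp: dist_norm)
  define \<phi> where "\<phi> = (\<lambda>u. k u / (of_real (2*L) - k u))"
  have nz: "of_real (2*L) - k u \<noteq> 0" if "norm u < 1" for u
  proof
    assume "of_real (2*L) - k u = 0"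
    then have "k u = complex_of_real (2*L)" by simp
    then have "Re (k u) = 2*L" by (metis Re_complex_of_real)
    with Rek[OF that] L show False by simp
  qed
  have small: "norm (k u) < norm (of_real (2*L) - k u)" if "norm u < 1" for u
  proof -
    have "(norm (k u))\<^sup>2 < (norm (of_real (2*L) - k u))\<^sup>2"
      using Rek[OF that] L unfolding cmod_power2 by (simp add: power2_eq_square algebra_simps)
    then show ?thesis
      by (rule power2_less_imp_less) simp
  qed
  have schw: "norm (\<phi> u) \<le> norm u" if "norm u < 1" for u
  proof (rule Schwarz_Lemma(1))
    show "\<phi> holomorphic_on ball 0 1"
      unfolding \<phi>_def by (intro holomorphic_intros kh) (use nz in auto)
    show "\<phi> 0 = 0" by (simp add: \<phi>_def k_def gw)
    show "norm (\<phi> z) < 1" if "norm z < 1" for z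
      using small[OF that] nz[OF that] unfolding \<phi>_def norm_divide by (simp add: divide_less_eq)
  qed (rule that)
  define u where "u = (z - w) / of_real R"
  have nu: "norm u < 1/2"
    using z \<open>R > 0\<close> by (simp add: u_def norm_divide dist_norm norm_minus_commute field_simps)
  have gk: "g z = k u"
    using \<open>R > 0\<close> by (simp add: k_def u_def)
  have "norm (k u) \<le> norm u * norm (of_real (2*L) - k u)"
    using schw[of u] nz[of u] nu unfolding \<phi>_def norm_divide by (simp add: pos_divide_le_eq)
  also have "\<dots> \<le> 1/2 * (2*L + norm (k u))"
    using nu L norm_triangle_ineq4[of "of_real (2*L)" "k u"] by (intro mult_mono) auto
  finally show ?thesis unfolding gk by simp
qed

lemma entire_not_constant_zeros_finite:
  assumes "F holomorphic_on UNIV" "\<exists>z. F z \<noteq> 0" "compact K"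
  shows "finite {z \<in> K. F z = 0}"
proof (cases "\<exists>z. F z = 0")
  case True
  then have "\<not> F constant_on UNIV"
    using assms(2) unfolding constant_on_def by (metis UNIV_I)
  then show ?thesis
    using holomorphic_compact_finite_zeros[OF assms(1) open_UNIV connected_UNIV assms(3)] by simp
qed auto

lemma entire_bounded_on_cball:
  assumes "F holomorphic_on UNIV"
  obtains C where "\<And>z. norm z \<le> X \<Longrightarrow> norm (F z) \<le> C"
proof -
  have "bounded (F ` cball 0 X)"
    using assms by (intro compact_imp_bounded compact_continuous_image)
      (auto intro: holomorphic_on_imp_continuous_on holomorphic_on_subset)
  then show thesis
    using that unfolding bounded_iff by (metis dist_0_norm imageI mem_cball)
qed

lemma entire_maximum_modulus_cball:
  assumes hol: "F holomorphic_on UNIV" and bd: "\<And>z. z \<in> sphere w R \<Longrightarrow> norm (F z) \<le> K"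
    and z: "z \<in> cball w R"
  shows "norm (F z) \<le> K"
proof (cases "R = 0")
  case False
  then have "R > 0" using z zero_le_dist[of w z] by (simp del: zero_le_dist)
  show ?thesis
  proof (rule maximum_modulus_frontier[of F "cball w R"])
    show "F holomorphic_on interior (cball w R)" "continuous_on (closure (cball w R)) F"
      using hol holomorphic_on_subset holomorphic_on_imp_continuous_on by blast+
  qed (use \<open>R > 0\<close> z bd in auto)
qed (use z bd in auto)

lemma entire_divide_out_zero:
  assumes hol: "F holomorphic_on UNIV" and nz: "\<exists>z. F z \<noteq> 0"
  obtains k :: nat and h where "h holomorphic_on UNIV" "h a \<noteq> 0" "\<And>z. F z = (z - a) ^ k * h z"
proof -
  define n where "n = nat (zorder F a)"
  define g where "g = zor_poly F a"
  obtain r where r: "r > 0" "g holomorphic_on cball a r"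
      "\<And>w. w \<in> cball a r \<Longrightarrow> F w = g w * (w - a) ^ n \<and> g w \<noteq> 0"
    using zorder_exist_zero[OF hol open_UNIV connected_UNIV, of a] nz
    unfolding n_def g_def by blast
  define h where "h = (\<lambda>z. if z = a then g a else F z / (z - a) ^ n)"
  have hg: "h z = g z" if "z \<in> cball a r" for z
    using r(3)[OF that] by (auto simp: h_def)
  have "h holomorphic_on UNIV"
  proof (rule no_isolated_singularity[where K = "{a}"])
    have out: "h holomorphic_on (UNIV - {a})"
      by (rule holomorphic_transform[of "\<lambda>z. F z / (z - a) ^ n"])
         (auto simp: h_def intro!: holomorphic_intros holomorphic_on_subset[OF hol])
    then show "h holomorphic_on (UNIV - {a})" .
    have "continuous_on (ball a r) h"
      by (rule continuous_on_eq[of _ g])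
         (auto simp: hg intro!: holomorphic_on_imp_continuous_on holomorphic_on_subset[OF r(2)])
    moreover have "continuous_on (UNIV - {a}) h"
      by (rule holomorphic_on_imp_continuous_on[OF out])
    ultimately have "continuous_on (ball a r \<union> (UNIV - {a})) h"
      by (intro continuous_on_open_Un) auto
    moreover have "ball a r \<union> (UNIV - {a}) = UNIV"
      using r(1) by auto
    ultimately show "continuous_on UNIV h" by simp
  qed auto
  moreover have "h a \<noteq> 0"
    using r(1) r(3)[of a] by (simp add: h_def)
  moreover have "F z = (z - a) ^ n * h z" for z
    using r(1) r(3)[of a] by (cases "z = a") (auto simp: h_def)
  ultimately show thesis by (rule that)
qed

lemma entire_divide_out_zeros:
  assumes hol: "F holomorphic_on UNIV" and nz: "\<exists>z. F z \<noteq> 0" and "finite S"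
  obtains m :: "complex \<Rightarrow> nat" and h where "h holomorphic_on UNIV" "\<And>a. a \<in> S \<Longrightarrow> h a \<noteq> 0"
     "\<And>z. F z = (\<Prod>a\<in>S. (z - a) ^ m a) * h z"
proof -
  have "\<exists>m h. h holomorphic_on UNIV \<and> (\<forall>a\<in>S. h a \<noteq> 0) \<and> (\<forall>z. F z = (\<Prod>a\<in>S. (z - a) ^ m a) * h z)"
    using \<open>finite S\<close>
  proof (induction S)
    case empty
    show ?case using hol by (intro exI[of _ "\<lambda>_. 0"] exI[of _ F]) simp
  next
    case (insert a S)
    then obtain m h where h: "h holomorphic_on UNIV" "\<forall>a\<in>S. h a \<noteq> 0"
        "\<And>z. F z = (\<Prod>a\<in>S. (z - a) ^ m a) * h z"
      by blast
    have "\<exists>z. h z \<noteq> 0" using nz h(3) by force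
    then obtain k h' where h': "h' holomorphic_on UNIV" "h' a \<noteq> 0" "\<And>z. h z = (z - a) ^ k * h' z"
      using entire_divide_out_zero[OF h(1)] by blast
    have "(\<Prod>b\<in>S. (z - b) ^ (m(a := k)) b) = (\<Prod>b\<in>S. (z - b) ^ m b)" for z
      using insert.hyps by (intro prod.cong) auto
    then show ?case
      using insert.hyps h h' by (intro exI[of _ "m(a := k)"] exI[of _ h']) auto
  qed
  then show thesis using that by blast
qed

text \<open>
  The substitute for the Poisson-Jensen formula. Dividing \<open>F\<close> by its zeros in the disc of radius
  \<open>R/3\<close> leaves a function \<open>h\<close> without zeros there. On the circle of radius \<open>R\<close> every factor \<open>z - a\<close> has
  modulus at least \<open>2 R/3\<close>, whereas at the centre it is at most \<open>R/3\<close>. By the maximum principle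
  \<open>\<bar>h z / h w\<bar> \<le> e\<^sup>L / 2\<^sup>N\<close> with \<open>N\<close> the number of zeros. At \<open>z = w\<close> this bounds \<open>N\<close>; for the other \<open>z\<close> it
  bounds the real part of a branch \<open>\<phi>\<close> of the logarithm of \<open>h / h w\<close>, hence \<open>\<phi>\<close> itself by
  Borel-Caratheodory.
\<close>

lemma entire_local_factorization:
  assumes hol: "F holomorphic_on UNIV" and Fw: "F w \<noteq> 0" and R: "R > 0"
    and bd: "\<And>z. z \<in> cball w R \<Longrightarrow> norm (F z) \<le> exp M"
  defines "S \<equiv> {z \<in> cball w (R/3). F z = 0}" and "L \<equiv> M - ln (norm (F w))"
  obtains m :: "complex \<Rightarrow> nat" and h \<phi> where
    "finite S" "L \<ge> 0"
    "\<And>a. a \<in> S \<Longrightarrow> m a \<ge> 1"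
    "h holomorphic_on UNIV"
    "\<And>z. F z = (\<Prod>a\<in>S. (z - a) ^ m a) * h z"
    "real (\<Sum>a\<in>S. m a) * ln 2 \<le> L"
    "\<phi> holomorphic_on ball w (R/3)"
    "\<And>z. z \<in> ball w (R/3) \<Longrightarrow> h z = h w * exp (\<phi> z)"
    "\<And>z. z \<in> ball w (R/6) \<Longrightarrow> norm (\<phi> z) \<le> 2 * (L + 1)"
    "norm (F w) \<le> (R/3) ^ (\<Sum>a\<in>S. m a) * norm (h w)"
proof -
  have fin: "finite S"
    unfolding S_def by (rule entire_not_constant_zeros_finite[OF hol]) (use Fw in auto)
  obtain m :: "complex \<Rightarrow> nat" and h where h: "h holomorphic_on UNIV" "\<And>a. a \<in> S \<Longrightarrow> h a \<noteq> 0"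
     "\<And>z. F z = (\<Prod>a\<in>S. (z - a) ^ m a) * h z"
    using entire_divide_out_zeros[OF hol _ fin] Fw by metis
  define N where "N = (\<Sum>a\<in>S. m a)"
  have m1: "m a \<ge> 1" if "a \<in> S" for a
  proof (rule ccontr)
    assume "\<not> m a \<ge> 1"
    then have "m a = 0" by simp
    have "F a = 0" using that by (simp add: S_def)
    then have "(\<Prod>b\<in>S. (a - b) ^ m b) = 0" using h(2)[OF that] h(3)[of a] by simp
    then obtain b where "b \<in> S" "(a - b) ^ m b = 0" using fin by auto
    with \<open>m a = 0\<close> show False by (cases "a = b") auto
  qed
  have hnz: "h z \<noteq> 0" if "z \<in> cball w (R/3)" for z
    using h(2)[of z] h(3)[of z] that by (cases "F z = 0") (auto simp: S_def)
  have prodnorm: "norm (\<Prod>a\<in>S. (z - a) ^ m a) = (\<Prod>a\<in>S. norm (z - a) ^ m a)" for z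
    by (simp add: prod_norm[symmetric] norm_power)
  have hw0: "norm (F w) \<le> (R/3) ^ N * norm (h w)"
  proof -
    have "(\<Prod>a\<in>S. norm (w - a) ^ m a) \<le> (\<Prod>a\<in>S. (R/3) ^ m a)"
      by (intro prod_mono conjI power_mono) (auto simp: S_def dist_norm)
    then show ?thesis
      unfolding h(3)[of w] norm_mult prodnorm N_def power_sum
      by (intro mult_right_mono) auto
  qed
  have sph: "norm (h z) \<le> exp M / (2*R/3) ^ N" if "z \<in> sphere w R" for z
  proof -
    have *: "norm (z - a) \<ge> 2*R/3" if "a \<in> S" for a
    proof -
      have "R \<le> dist w a + dist a z"
        using \<open>z \<in> sphere w R\<close> dist_triangle[of w z a] by simp
      with that show ?thesis by (auto simp: S_def dist_norm norm_minus_commute)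
    qed
    have "(\<Prod>a\<in>S. (2*R/3) ^ m a) \<le> (\<Prod>a\<in>S. norm (z - a) ^ m a)"
      using R * by (intro prod_mono conjI power_mono) auto
    then have "(2*R/3) ^ N * norm (h z) \<le> norm (F z)"
      unfolding h(3)[of z] norm_mult prodnorm N_def power_sum
      by (intro mult_right_mono) auto
    also have "\<dots> \<le> exp M" using that by (intro bd) auto
    finally show ?thesis using R by (simp add: pos_le_divide_eq mult.commute)
  qed
  have hin: "norm (h z) \<le> exp M / (2*R/3) ^ N" if "z \<in> cball w R" for z
    by (rule entire_maximum_modulus_cball[OF h(1) sph that])
  have ratio: "norm (h z) \<le> exp L / 2 ^ N * norm (h w)" if "z \<in> cball w R" for z
  proof -
    have "norm (h z) \<le> exp M / (2*R/3) ^ N" by (rule hin[OF that])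
    also have "(2*R/3) ^ N = 2 ^ N * (R/3) ^ N" by (simp add: power_mult_distrib power_divide)
    also have "exp M / (2 ^ N * (R/3) ^ N) = exp L / 2 ^ N * (norm (F w) / (R/3) ^ N)"
      using Fw by (simp add: L_def exp_diff)
    also have "\<dots> \<le> exp L / 2 ^ N * norm (h w)"
      using hw0 R by (intro mult_left_mono) (auto simp: divide_simps mult.commute)
    finally show ?thesis .
  qed
  have hw: "h w \<noteq> 0" using hnz[of w] R by simp
  have "2 ^ N \<le> exp L"
    using ratio[of w] hw R by (simp add: field_simps)
  then have "ln (2 ^ N) \<le> ln (exp L)" by (subst ln_le_cancel_iff) auto
  then have NL: "real N * ln 2 \<le> L" by (simp add: ln_realpow)
  have "0 \<le> real N * ln 2" by simp
  with NL have L0: "L \<ge> 0" by linarith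
  define h1 where "h1 = (\<lambda>z. h z / h w)"
  have h1h: "h1 holomorphic_on ball w (R/3)"
    unfolding h1_def using hw by (intro holomorphic_intros holomorphic_on_subset[OF h(1)]) auto
  have h1nz: "h1 z \<noteq> 0" if "z \<in> ball w (R/3)" for z
    using hnz[of z] that hw by (auto simp: h1_def)
  obtain g where g: "g holomorphic_on ball w (R/3)" "\<And>z. z \<in> ball w (R/3) \<Longrightarrow> h1 z = exp (g z)"
    using holomorphic_log_ex[OF open_ball convex_ball h1h h1nz] by metis
  define \<phi> where "\<phi> = (\<lambda>z. g z - g w)"
  have wb: "w \<in> ball w (R/3)" using R by simp
  have gw: "exp (g w) = 1" using g(2)[OF wb] hw by (simp add: h1_def)
  have \<phi>h: "\<phi> holomorphic_on ball w (R/3)" unfolding \<phi>_def by (intro holomorphic_intros g)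
  have exp\<phi>: "h z = h w * exp (\<phi> z)" if "z \<in> ball w (R/3)" for z
    using g(2)[OF that] hw gw by (simp add: \<phi>_def exp_diff h1_def field_simps)
  have Re\<phi>: "Re (\<phi> z) < L + 1" if "z \<in> ball w (R/3)" for z
  proof -
    have "norm (h z) \<le> exp L / 2 ^ N * norm (h w)" using that R by (intro ratio) auto
    also have "\<dots> \<le> exp L * norm (h w)"
      by (intro mult_right_mono) (auto simp: divide_simps intro: mult_left_mono[of 1, simplified])
    finally have "exp (Re (\<phi> z)) \<le> exp L"
      using hw unfolding exp\<phi>[OF that] norm_mult norm_exp_eq_Re by (simp add: mult.commute)
    then show ?thesis by simp
  qed
  have b6: "norm (\<phi> z) \<le> 2 * (L + 1)" if "z \<in> ball w (R/6)" for z
    by (rule Borel_Caratheodory_half[of \<phi> w "R/3"]) (use \<phi>h R Re\<phi> that in \<open>auto simp: \<phi>_def\<close>)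
  show thesis
    by (rule that[of m h \<phi>]) (use fin L0 m1 h(1,3) NL \<phi>h exp\<phi> b6 hw0 in \<open>auto simp: N_def\<close>)
qed

lemma has_field_derivative_prod_power:
  fixes m :: "complex \<Rightarrow> nat"
  assumes "finite S" "z \<notin> S"
  shows "((\<lambda>z. \<Prod>a\<in>S. (z - a) ^ m a) has_field_derivative
          (\<Prod>a\<in>S. (z - a) ^ m a) * (\<Sum>a\<in>S. of_nat (m a) / (z - a))) (at z)"
  using assms
proof (induction S)
  case (insert a S)
  then have IH: "((\<lambda>z. \<Prod>a\<in>S. (z - a) ^ m a) has_field_derivative
          (\<Prod>a\<in>S. (z - a) ^ m a) * (\<Sum>a\<in>S. of_nat (m a) / (z - a))) (at z)" and za: "z \<noteq> a"
    by auto
  have "((\<lambda>z. (z - a) ^ m a) has_field_derivative of_nat (m a) * (z - a) ^ (m a - 1)) (at z)"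
    by (auto intro!: derivative_eq_intros)
  moreover have "of_nat (m a) * (z - a) ^ (m a - 1) = (z - a) ^ m a * (of_nat (m a) / (z - a))"
    using za by (cases "m a") auto
  ultimately have D: "((\<lambda>z. (z - a) ^ m a) has_field_derivative (z - a) ^ m a * (of_nat (m a) / (z - a))) (at z)"
    by simp
  show ?case
    using DERIV_mult[OF D IH] insert.hyps by (simp add: algebra_simps)
qed auto

text \<open>
  In the local factorization \<open>F'/F = \<phi>' + \<Sum> m a / (z - a)\<close>. Cauchy's estimate bounds \<open>\<phi>'\<close>; the sum has
  at most \<open>L / ln 2\<close> terms, counted with multiplicity, each of modulus at most \<open>1/\<delta>\<close>.
\<close>

lemma entire_log_deriv_bound:
  assumes hol: "F holomorphic_on UNIV" and Fw: "F w \<noteq> 0" and R: "R > 0"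
    and bd: "\<And>z. z \<in> cball w R \<Longrightarrow> norm (F z) \<le> exp M"
    and L: "M - ln (norm (F w)) \<le> L" and \<delta>: "\<delta> > 0"
    and z: "z \<in> ball w (R/12)" and far: "\<And>a. F a = 0 \<Longrightarrow> a \<in> cball w (R/3) \<Longrightarrow> norm (z - a) \<ge> \<delta>"
  shows "norm (deriv F z / F z) \<le> 48 * (L + 1) / R + 2 * L / \<delta>"
proof -
  define S where "S = {z \<in> cball w (R/3). F z = 0}"
  define L' where "L' = M - ln (norm (F w))"
  obtain m :: "complex \<Rightarrow> nat" and h \<phi> where *:
    "finite S" "L' \<ge> 0"
    "\<And>a. a \<in> S \<Longrightarrow> m a \<ge> 1"
    "h holomorphic_on UNIV"
    "\<And>z. F z = (\<Prod>a\<in>S. (z - a) ^ m a) * h z"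
    "real (\<Sum>a\<in>S. m a) * ln 2 \<le> L'"
    "\<phi> holomorphic_on ball w (R/3)"
    "\<And>z. z \<in> ball w (R/3) \<Longrightarrow> h z = h w * exp (\<phi> z)"
    "\<And>z. z \<in> ball w (R/6) \<Longrightarrow> norm (\<phi> z) \<le> 2 * (L' + 1)"
    "norm (F w) \<le> (R/3) ^ (\<Sum>a\<in>S. m a) * norm (h w)"
    by (rule entire_local_factorization[OF hol Fw R bd, folded S_def L'_def]) (assumption | rule that)+
  have zS: "z \<notin> S" using far[of z] \<delta> by (auto simp: S_def)
  have z3: "z \<in> ball w (R/3)" using z R by auto
  define P where "P = (\<lambda>z. \<Prod>a\<in>S. (z - a) ^ m a)"
  define \<Sigma> where "\<Sigma> = (\<Sum>a\<in>S. of_nat (m a) / (z - a))"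
  have DP: "(P has_field_derivative P z * \<Sigma>) (at z)"
    unfolding P_def \<Sigma>_def by (rule has_field_derivative_prod_power[OF *(1) zS])
  have D\<phi>: "(\<phi> has_field_derivative deriv \<phi> z) (at z)"
    by (rule holomorphic_derivI[OF *(7) open_ball z3])
  have "((\<lambda>z. P z * (h w * exp (\<phi> z))) has_field_derivative P z * (h w * exp (\<phi> z)) * (\<Sigma> + deriv \<phi> z)) (at z)"
    by (rule derivative_eq_intros DP D\<phi> refl)+ (simp add: algebra_simps)
  moreover have "\<And>y. y \<in> ball w (R/3) \<Longrightarrow> P y * (h w * exp (\<phi> y)) = F y"
    using *(5,8) by (simp add: P_def)
  ultimately have "(F has_field_derivative F z * (\<Sigma> + deriv \<phi> z)) (at z)"
    using z3 by (metis (no_types, lifting) has_field_derivative_transform_within_open open_ball)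
  then have "deriv F z = F z * (\<Sigma> + deriv \<phi> z)" by (rule DERIV_imp_deriv)
  moreover have "F z \<noteq> 0" using z3 zS by (auto simp: S_def)
  ultimately have eq: "deriv F z / F z = \<Sigma> + deriv \<phi> z" by simp
  have L'L: "L' \<le> L" using L by (simp add: L'_def)
  have "norm ((deriv ^^ 1) \<phi> z) \<le> fact 1 * (2 * (L' + 1)) / (R/12/2) ^ 1"
  proof (rule Cauchy_inequality)
    \<comment> \<open>The disc for Cauchy's estimate must stay where \<open>\<phi>\<close> is bounded.\<close>
    have sub: "cball z (R/12/2) \<subseteq> ball w (R/6)"
    proof
      fix y assume "y \<in> cball z (R/12/2)"
      then show "y \<in> ball w (R/6)"
        using z dist_triangle[of w y z] R by simp
    qed
    then have sub3: "cball z (R/12/2) \<subseteq> ball w (R/3)" using R by force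
    show "\<phi> holomorphic_on ball z (R/12/2)" using *(7) sub3 ball_subset_cball by (meson holomorphic_on_subset order_trans)
    show "continuous_on (cball z (R/12/2)) \<phi>" using *(7) sub3 holomorphic_on_imp_continuous_on holomorphic_on_subset by blast
    show "norm (\<phi> x) \<le> 2 * (L' + 1)" if "norm (z - x) = R/12/2" for x
      using sub that by (intro *(9)) (auto simp: dist_norm)
  qed (use R in auto)
  then have "norm (deriv \<phi> z) \<le> 48 * (L' + 1) / R" by simp
  have "norm \<Sigma> \<le> (\<Sum>a\<in>S. real (m a) / \<delta>)"
    unfolding \<Sigma>_def
  proof (rule sum_norm_le)
    fix a assume a: "a \<in> S"
    then have "norm (z - a) \<ge> \<delta>" using far by (auto simp: S_def)
    then show "norm (of_nat (m a) / (z - a)) \<le> real (m a) / \<delta>"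
      using \<delta> by (simp add: norm_divide frac_le)
  qed
  also have "\<dots> = real (\<Sum>a\<in>S. m a) / \<delta>" by (simp add: sum_divide_distrib)
  also have "\<dots> \<le> (2 * L) / \<delta>"
  proof -
    have "real (\<Sum>a\<in>S. m a) * (1/2) \<le> real (\<Sum>a\<in>S. m a) * ln 2"
      using ln2_ge_two_thirds by (intro mult_left_mono of_nat_0_le_iff) auto
    then show ?thesis using *(6) L'L \<delta> by (intro divide_right_mono) linarith+
  qed
  finally have "norm \<Sigma> \<le> 2 * L / \<delta>" .
  have "norm (deriv \<phi> z) \<le> 48 * (L + 1) / R"
    using \<open>norm (deriv \<phi> z) \<le> 48 * (L' + 1) / R\<close>
    by (rule order_trans) (use L'L R in \<open>auto intro!: divide_right_mono\<close>)
  show ?thesis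
    unfolding eq using norm_triangle_ineq[of \<Sigma> "deriv \<phi> z"]
      \<open>norm \<Sigma> \<le> 2 * L / \<delta>\<close> \<open>norm (deriv \<phi> z) \<le> 48 * (L + 1) / R\<close> by linarith
qed

lemma entire_zeros_card_bound:
  assumes hol: "F holomorphic_on UNIV" and Fw: "F w \<noteq> 0" and R: "R > 0"
    and bd: "\<And>z. z \<in> cball w R \<Longrightarrow> norm (F z) \<le> exp M"
  shows "real (card {z \<in> cball w (R/3). F z = 0}) \<le> 2 * (M - ln (norm (F w)))"
proof -
  define S where "S = {z \<in> cball w (R/3). F z = 0}"
  define L' where "L' = M - ln (norm (F w))"
  obtain m :: "complex \<Rightarrow> nat" where *:
    "finite S" "\<And>a. a \<in> S \<Longrightarrow> m a \<ge> 1" "real (\<Sum>a\<in>S. m a) * ln 2 \<le> L'"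
    using entire_local_factorization[OF hol Fw R bd, folded S_def L'_def] by metis
  have "real (card S) * (1/2) \<le> real (\<Sum>a\<in>S. m a) * (1/2)"
    using sum_mono[of S "\<lambda>_. 1" m] *(2) by (simp flip: of_nat_sum)
  also have "\<dots> \<le> real (\<Sum>a\<in>S. m a) * ln 2"
    using ln2_ge_two_thirds by (intro mult_left_mono of_nat_0_le_iff) auto
  also have "\<dots> \<le> L'" by (rule *(3))
  finally show ?thesis by (simp add: S_def L'_def)
qed

text \<open>
  An entire quotient \<open>H = G / F\<close> grows no faster than \<open>F\<close> and \<open>G\<close> do, although \<open>F\<close> may be small: if \<open>P\<close>
  is the product of the factors \<open>z - a\<close> of \<open>F\<close>, then \<open>H = (G / P) / h\<close>, where the maximum principle
  bounds \<open>G / P = h H\<close> from above and the logarithm \<open>\<phi>\<close> bounds \<open>h\<close> from below.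
\<close>

lemma entire_quotient_bound:
  assumes hol: "F holomorphic_on UNIV" and Fw: "F w \<noteq> 0" and R: "R > 0"
    and bd: "\<And>z. z \<in> cball w R \<Longrightarrow> norm (F z) \<le> exp M"
    and bdG: "\<And>z. z \<in> cball w R \<Longrightarrow> norm (F z * H z) \<le> exp K"
    and holH: "H holomorphic_on UNIV"
    and z: "z \<in> ball w (R/6)"
  shows "norm (H z) \<le> exp (K + 2 * M + 2 - 3 * ln (norm (F w)))"
proof -
  define S where "S = {z \<in> cball w (R/3). F z = 0}"
  define L where "L = M - ln (norm (F w))"
  obtain m :: "complex \<Rightarrow> nat" and h \<phi> where *:
    "finite S" "L \<ge> 0"
    "\<And>a. a \<in> S \<Longrightarrow> m a \<ge> 1"
    "h holomorphic_on UNIV"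
    "\<And>z. F z = (\<Prod>a\<in>S. (z - a) ^ m a) * h z"
    "real (\<Sum>a\<in>S. m a) * ln 2 \<le> L"
    "\<phi> holomorphic_on ball w (R/3)"
    "\<And>z. z \<in> ball w (R/3) \<Longrightarrow> h z = h w * exp (\<phi> z)"
    "\<And>z. z \<in> ball w (R/6) \<Longrightarrow> norm (\<phi> z) \<le> 2 * (L + 1)"
    "norm (F w) \<le> (R/3) ^ (\<Sum>a\<in>S. m a) * norm (h w)"
    by (rule entire_local_factorization[OF hol Fw R bd, folded S_def L_def]) (assumption | rule that)+
  define N where "N = (\<Sum>a\<in>S. m a)"
  have sph: "norm (h z * H z) \<le> exp K / (2*R/3) ^ N" if "z \<in> sphere w R" for z
  proof -
    have far: "norm (z - a) \<ge> 2*R/3" if "a \<in> S" for a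
    proof -
      have "R \<le> dist w a + dist a z"
        using \<open>z \<in> sphere w R\<close> dist_triangle[of w z a] by simp
      with that show ?thesis by (auto simp: S_def dist_norm norm_minus_commute)
    qed
    have "(2*R/3) ^ N \<le> norm (\<Prod>a\<in>S. (z - a) ^ m a)"
      using R far unfolding prod_norm[symmetric] norm_power N_def power_sum
      by (intro prod_mono conjI power_mono) auto
    then have "(2*R/3) ^ N * norm (h z * H z) \<le> norm (\<Prod>a\<in>S. (z - a) ^ m a) * norm (h z * H z)"
      by (rule mult_right_mono) simp
    also have "\<dots> = norm (F z * H z)"
      unfolding *(5)[of z] norm_mult by simp
    also have "\<dots> \<le> exp K" using that by (intro bdG) auto
    finally show ?thesis using R by (simp add: pos_le_divide_eq mult.commute)
  qed
  have "norm (h z * H z) \<le> exp K / (2*R/3) ^ N"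
    by (rule entire_maximum_modulus_cball[OF holomorphic_on_mult[OF *(4) holH] sph]) (use z R in auto)
  also have "(2*R/3) ^ N = 2 ^ N * (R/3) ^ N" by (simp add: power_mult_distrib power_divide)
  also have "exp K / (2 ^ N * (R/3) ^ N) \<le> exp K / (R/3) ^ N"
    using R by (intro divide_left_mono) (auto intro!: mult_right_mono[of 1, simplified])
  finally have hH: "norm (h z) * norm (H z) \<le> exp K / (R/3) ^ N" by (simp add: norm_mult)
  have z3: "z \<in> ball w (R/3)" using z R by auto
  have "norm (h z) = norm (h w) * exp (Re (\<phi> z))"
    unfolding *(8)[OF z3] by (simp add: norm_mult)
  moreover have "Re (\<phi> z) \<ge> - (2 * (L + 1))"
    using *(9)[OF z] abs_Re_le_cmod[of "\<phi> z"] by linarith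
  ultimately have "norm (h w) * exp (- (2 * (L + 1))) \<le> norm (h z)"
    by (simp add: mult_left_mono)
  moreover have "norm (F w) / (R/3) ^ N \<le> norm (h w)"
    using *(10) R by (simp add: N_def divide_le_eq mult.commute)
  ultimately have "norm (F w) / (R/3) ^ N * exp (- (2 * (L + 1))) \<le> norm (h z)"
    by (meson exp_ge_zero mult_right_mono order_trans)
  then have "norm (F w) / (R/3) ^ N * exp (- (2 * (L + 1))) * norm (H z) \<le> norm (h z) * norm (H z)"
    by (rule mult_right_mono) simp
  also note hH
  finally have "norm (F w) * exp (- (2 * (L + 1))) * norm (H z) \<le> exp K"
    using R by (simp add: field_simps)
  moreover have "norm (F w) = exp (ln (norm (F w)))" using Fw by simp
  ultimately have "exp (ln (norm (F w)) - 2 * (L + 1)) * norm (H z) \<le> exp K"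
    by (simp add: exp_diff exp_minus exp_add field_simps)
  then have "norm (H z) \<le> exp K / exp (ln (norm (F w)) - 2 * (L + 1))"
    by (simp add: field_simps)
  also have "\<dots> = exp (K + 2 * M + 2 - 3 * ln (norm (F w)))"
    unfolding exp_diff[symmetric] by (simp add: L_def algebra_simps)
  finally show ?thesis .
qed

section \<open>Phragmen-Lindelof along a sequence of circles\<close>

lemma filterlim_exp_diff_exp_at_bot:
  fixes \<sigma> s d :: real
  assumes "d > 0" "s > 0" "\<sigma> < s"
  shows "filterlim (\<lambda>x. exp (\<sigma> * x) - d * exp (s * x)) at_bot at_top"
proof -
  have "((\<lambda>x. exp (- ((s - \<sigma>) * x)) - d) \<longlongrightarrow> 0 - d) at_top"
  proof (intro tendsto_intros filterlim_compose[OF exp_at_bot])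
    have "filterlim (\<lambda>x. (s - \<sigma>) * x) at_top at_top"
      using assms by (intro filterlim_tendsto_pos_mult_at_top[OF tendsto_const] filterlim_ident) auto
    then show "filterlim (\<lambda>x. - ((s - \<sigma>) * x)) at_bot at_top"
      by (simp add: filterlim_uminus_at_top)
  qed
  moreover have "filterlim (\<lambda>x. exp (s * x)) at_top at_top"
    using assms by (intro filterlim_compose[OF exp_at_top]
        filterlim_tendsto_pos_mult_at_top[OF tendsto_const] filterlim_ident) auto
  ultimately have "filterlim (\<lambda>x. (exp (- ((s - \<sigma>) * x)) - d) * exp (s * x)) at_bot at_top"
    using assms by (intro filterlim_tendsto_neg_mult_at_bot) auto
  moreover have "(exp (- ((s - \<sigma>) * x)) - d) * exp (s * x) = exp (\<sigma> * x) - d * exp (s * x)" for x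
    by (simp add: algebra_simps exp_add[symmetric])
  ultimately show ?thesis by simp
qed

text \<open>
  The half strip is the image of a sector outside the unit disc under the logarithm, so that circles become vertical
  segments and a growth \<open>exp (r\<^sup>\<sigma>)\<close> becomes \<open>exp (exp (\<sigma> x))\<close>. Because \<open>s \<gamma> < \<pi>/2\<close>, the factor
  \<open>exp (- \<epsilon> exp (s w))\<close> is bounded by \<open>1\<close> on the strip and decays faster than \<open>G\<close> can grow on the given
  vertical segments. The maximum principle on the rectangles that they cut off bounds the product;
  then \<open>\<epsilon>\<close> tends to \<open>0\<close>. Arbitrarily distant segments suffice, which is why a bound on the lower order
  can be used.
\<close>

lemma Phragmen_Lindelof_half_strip:
  fixes G :: "complex \<Rightarrow> complex"
  assumes hol: "G holomorphic_on UNIV"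
    and s: "s > 0" "\<gamma> > 0" "s * \<gamma> < pi / 2" and \<sigma>: "\<sigma> < s" and C: "C > 0"
    and side: "\<And>w. Re w \<ge> 0 \<Longrightarrow> \<bar>Im w\<bar> = \<gamma> \<Longrightarrow> norm (G w) \<le> C"
    and left: "\<And>w. Re w = 0 \<Longrightarrow> \<bar>Im w\<bar> \<le> \<gamma> \<Longrightarrow> norm (G w) \<le> C"
    and far: "\<And>X. \<exists>x\<ge>X. \<forall>w. Re w = x \<longrightarrow> \<bar>Im w\<bar> \<le> \<gamma> \<longrightarrow> norm (G w) \<le> exp (exp (\<sigma> * x))"
    and w: "Re w \<ge> 0" "\<bar>Im w\<bar> \<le> \<gamma>"
  shows "norm (G w) \<le> C"
proof -
  define c where "c = cos (s * \<gamma>)"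
  have c: "c > 0" unfolding c_def using s by (intro cos_gt_zero) auto
  have cosge: "cos (s * Im w) \<ge> c" if "\<bar>Im w\<bar> \<le> \<gamma>" for w
  proof -
    have "s * \<gamma> \<le> pi" using s(3) pi_gt_zero by linarith
    then have "cos \<bar>s * Im w\<bar> \<ge> cos (s * \<gamma>)"
      using s(1) that by (intro cos_monotone_0_pi_le) (auto simp: abs_mult)
    then show ?thesis by (simp add: c_def)
  qed
  have nexp: "norm (exp (- (of_real \<epsilon> * exp (of_real s * w)))) = exp (- (\<epsilon> * exp (s * Re w) * cos (s * Im w)))"
    for \<epsilon> and w :: complex
    by (simp add: Re_exp)
  have damp: "norm (G w * exp (- (of_real \<epsilon> * exp (of_real s * w)))) \<le> C" if \<epsilon>: "\<epsilon> > 0" for \<epsilon>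
  proof -
    have "filterlim (\<lambda>x. exp (\<sigma> * x) - (\<epsilon> * c) * exp (s * x)) at_bot at_top"
      by (rule filterlim_exp_diff_exp_at_bot) (use \<epsilon> c \<sigma> s in auto)
    then have "eventually (\<lambda>x. exp (\<sigma> * x) - (\<epsilon> * c) * exp (s * x) \<le> ln C) at_top"
      by (simp add: filterlim_at_bot)
    then obtain X where X: "\<And>x. x \<ge> X \<Longrightarrow> exp (\<sigma> * x) - (\<epsilon> * c) * exp (s * x) \<le> ln C"
      by (auto simp: eventually_at_top_linorder)
    obtain x where x: "x \<ge> max X (Re w + 1)"
        "\<And>w. Re w = x \<Longrightarrow> \<bar>Im w\<bar> \<le> \<gamma> \<Longrightarrow> norm (G w) \<le> exp (exp (\<sigma> * x))"
      using far by blast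
    define Q where "Q = cbox (Complex 0 (-\<gamma>)) (Complex x \<gamma>)"
    define K where "K = (\<lambda>w. G w * exp (- (of_real \<epsilon> * exp (of_real s * w))))"
    have Kh: "K holomorphic_on UNIV" unfolding K_def by (intro holomorphic_intros hol)
    have "norm (K w) \<le> C"
    proof (rule maximum_modulus_frontier[of K Q])
      show "K holomorphic_on interior Q" using Kh holomorphic_on_subset by blast
      show "continuous_on (closure Q) K"
        using Kh holomorphic_on_imp_continuous_on holomorphic_on_subset by blast
      show "bounded Q" by (simp add: Q_def)
      show "w \<in> Q" using w x by (auto simp: Q_def in_cbox_complex_iff)
      fix u assume "u \<in> frontier Q"
      then have "u \<in> Q - box (Complex 0 (-\<gamma>)) (Complex x \<gamma>)"
        unfolding Q_def frontier_cbox .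
      then have u: "0 \<le> Re u" "\<bar>Im u\<bar> \<le> \<gamma>" "Re u = 0 \<or> \<bar>Im u\<bar> = \<gamma> \<or> Re u = x"
        by (auto simp: Q_def in_cbox_complex_iff in_box_complex_iff)
      have fac: "norm (exp (- (of_real \<epsilon> * exp (of_real s * u)))) \<le> exp (- (\<epsilon> * exp (s * Re u) * c))"
        unfolding nexp using cosge[OF u(2)] \<epsilon> by simp
      then have fac1: "norm (exp (- (of_real \<epsilon> * exp (of_real s * u)))) \<le> 1"
        by (rule order_trans) (use \<epsilon> c in simp)
      show "norm (K u) \<le> C"
      proof (cases "Re u = x")
        case True
        have "norm (K u) \<le> exp (exp (\<sigma> * x)) * exp (- (\<epsilon> * exp (s * x) * c))"
          unfolding K_def norm_mult using x(2)[OF True u(2)] fac True by (intro mult_mono) auto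
        also have "\<dots> = exp (exp (\<sigma> * x) - (\<epsilon> * c) * exp (s * x))"
          by (simp add: exp_add[symmetric] mult_ac)
        also have "\<dots> \<le> exp (ln C)" using X[of x] x(1) by simp
        finally show ?thesis using C by simp
      next
        case False
        then have "norm (G u) \<le> C" using u side left by blast
        then have "norm (K u) \<le> C * 1"
          unfolding K_def norm_mult using fac1 C by (intro mult_mono) auto
        then show ?thesis by simp
      qed
    qed
    then show ?thesis by (simp add: K_def)
  qed
  have "((\<lambda>\<epsilon>. norm (G w * exp (- (of_real \<epsilon> * exp (of_real s * w))))) \<longlongrightarrow> norm (G w * exp (- (of_real 0 * exp (of_real s * w))))) (at_right 0)"
    by (intro tendsto_intros)
  moreover have "\<forall>\<^sub>F \<epsilon> in at_right 0. norm (G w * exp (- (of_real \<epsilon> * exp (of_real s * w)))) \<le> C"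
    using damp by (auto simp: eventually_at_filter)
  ultimately have "norm (G w * exp (- (of_real 0 * exp (of_real s * w)))) \<le> C"
    by (intro tendsto_upperbound[where F = "at_right (0::real)"]) auto
  then show ?thesis by simp
qed

text \<open>
  The half strip estimate for \<open>B (exp (w + i \<mu>)) / exp (k w)\<close>, where \<open>\<mu>\<close> is the direction of the bisector.
  In logarithmic coordinates this function is entire, which spares a branch of the power in the sector.
\<close>

lemma power_bound_on_sector:
  fixes B :: "complex \<Rightarrow> complex"
  assumes hol: "B holomorphic_on UNIV"
    and \<theta>: "\<theta>1 < \<theta>2" and s: "s > 0" "s * (\<theta>2 - \<theta>1) < pi" and \<sigma>: "\<sigma> < s"
    and ray1: "\<And>r. r \<ge> 1 \<Longrightarrow> norm (B (of_real r * cis \<theta>1)) \<le> C * r ^ k"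
    and ray2: "\<And>r. r \<ge> 1 \<Longrightarrow> norm (B (of_real r * cis \<theta>2)) \<le> C * r ^ k"
    and far: "\<And>X. \<exists>r\<ge>X. \<forall>z. norm z = r \<longrightarrow> norm (B z) \<le> exp (r powr \<sigma>)"
  obtains C' where "\<And>r \<theta>. r \<ge> 1 \<Longrightarrow> \<theta> \<in> {\<theta>1..\<theta>2} \<Longrightarrow> norm (B (of_real r * cis \<theta>)) \<le> C' * r ^ k"
proof -
  \<comment> \<open>Half the opening, and the direction of the bisector.\<close>
  define \<gamma> where "\<gamma> = (\<theta>2 - \<theta>1) / 2"
  define \<mu> where "\<mu> = (\<theta>1 + \<theta>2) / 2"
  obtain C0 where C0: "\<And>z. norm z \<le> 1 \<Longrightarrow> norm (B z) \<le> C0"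
    using entire_bounded_on_cball[OF hol, of 1] by blast
  define C' where "C' = max 1 (max C C0)"
  define G where "G = (\<lambda>w. B (exp (w + \<i> * of_real \<mu>)) * exp (- of_nat k * w))"
  have Gh: "G holomorphic_on UNIV"
    unfolding G_def
    by (intro holomorphic_intros holomorphic_on_compose_gen[OF _ hol, unfolded o_def]) auto
  have nG: "norm (G w) = norm (B (of_real (exp (Re w)) * cis (Im w + \<mu>))) / exp (Re w) ^ k" for w
  proof -
    have "exp (w + \<i> * of_real \<mu>) = of_real (exp (Re w)) * cis (Im w + \<mu>)"
      by (simp add: exp_eq_polar)
    then show ?thesis
      by (simp add: G_def norm_mult exp_minus exp_of_nat_mult divide_inverse norm_inverse norm_power)
  qed
  have main: "norm (G w) \<le> C'" if w: "Re w \<ge> 0" "\<bar>Im w\<bar> \<le> \<gamma>" for w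
  proof (rule Phragmen_Lindelof_half_strip[OF Gh, of s \<gamma> \<sigma> C'])
    show "s > 0" "\<sigma> < s" by fact+
    show "\<gamma> > 0" "s * \<gamma> < pi / 2" using \<theta> s(2) by (auto simp: \<gamma>_def field_simps)
    show "C' > 0" by (simp add: C'_def)
    show "norm (G w) \<le> C'" if "Re w \<ge> 0" "\<bar>Im w\<bar> = \<gamma>" for w
    proof -
      have "Im w + \<mu> = \<theta>1 \<or> Im w + \<mu> = \<theta>2"
        using that(2) by (auto simp: \<gamma>_def \<mu>_def abs_if field_simps split: if_splits)
      then have "norm (B (of_real (exp (Re w)) * cis (Im w + \<mu>))) \<le> C * exp (Re w) ^ k"
        using ray1[of "exp (Re w)"] ray2[of "exp (Re w)"] that(1) by auto
      then have "norm (G w) \<le> C" unfolding nG by (simp add: divide_le_eq)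
      then show ?thesis by (simp add: C'_def)
    qed
    show "norm (G w) \<le> C'" if "Re w = 0" "\<bar>Im w\<bar> \<le> \<gamma>" for w
      unfolding nG using C0[of "cis (Im w + \<mu>)"] that by (simp add: C'_def)
    show "\<exists>x\<ge>X. \<forall>w. Re w = x \<longrightarrow> \<bar>Im w\<bar> \<le> \<gamma> \<longrightarrow> norm (G w) \<le> exp (exp (\<sigma> * x))" for X
    proof -
      obtain r where r: "r \<ge> exp (max X 0)" "\<And>z. norm z = r \<Longrightarrow> norm (B z) \<le> exp (r powr \<sigma>)"
        using far by blast
      have r1: "r \<ge> 1" using r(1) by (rule order_trans[rotated]) simp
      have "ln r \<ge> max X 0" using r(1) r1 by (subst ln_ge_iff) auto
      moreover have "norm (G w) \<le> exp (exp (\<sigma> * ln r))" if "Re w = ln r" for w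
      proof -
        have e: "exp (Re w) = r" using that r1 by simp
        have "norm (G w) \<le> norm (B (of_real r * cis (Im w + \<mu>)))"
          unfolding nG e using r1 mult_left_mono[of 1 "r ^ k" "norm (B (of_real r * cis (Im w + \<mu>)))"]
          by (simp add: divide_le_eq)
        also have "\<dots> \<le> exp (r powr \<sigma>)" using r1 by (intro r(2)) (simp add: norm_mult)
        finally show ?thesis using r1 by (simp add: powr_def)
      qed
      ultimately show ?thesis by (intro exI[of _ "ln r"]) auto
    qed
  qed (use w in auto)
  show thesis
  proof (rule that[of C'])
    fix r \<theta> :: real assume r: "r \<ge> 1" and t: "\<theta> \<in> {\<theta>1..\<theta>2}"
    have "norm (G (Complex (ln r) (\<theta> - \<mu>))) \<le> C'"
      using r t by (intro main) (auto simp: \<gamma>_def \<mu>_def abs_if field_simps)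
    then show "norm (B (of_real r * cis \<theta>)) \<le> C' * r ^ k"
      unfolding nG using r by (simp add: divide_le_eq)
  qed
qed

text \<open>
  Liouville's theorem for polynomial growth, with its Taylor sum read as an object of type poly.
\<close>

lemma entire_power_bound_imp_poly:
  assumes hol: "B holomorphic_on UNIV"
    and bd: "\<And>z. norm z \<ge> 1 \<Longrightarrow> norm (B z) \<le> C * norm z ^ n"
  shows "\<exists>p. \<forall>z. B z = poly p z"
proof -
  define c where "c = (\<lambda>k. (deriv ^^ k) B 0 / fact k)"
  have "B z = poly (\<Sum>k\<le>n. monom (c k) k) z" for z
    using Liouville_polynomial[OF hol, of 1 C n z] bd
    by (simp add: c_def poly_sum poly_monom)
  then show ?thesis by blast
qed

text \<open>
  By compactness of the set of directions, in the form of Bolzano's lemma for intervals, finitely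
  many of the given sectors cover the plane, so one constant serves for all of them.
\<close>

lemma locally_power_bound_imp_poly:
  assumes hol: "B holomorphic_on UNIV"
    and loc: "\<And>\<theta>. \<exists>\<theta>1 \<theta>2 C. \<theta>1 < \<theta> \<and> \<theta> < \<theta>2 \<and>
        (\<forall>r\<ge>1. \<forall>t\<in>{\<theta>1..\<theta>2}. norm (B (of_real r * cis t)) \<le> C * r ^ k)"
  shows "\<exists>p. \<forall>z. B z = poly p z"
proof -
  define P where "P = (\<lambda>a b. \<exists>C. \<forall>r\<ge>1. \<forall>t\<in>{a..b}. norm (B (of_real r * cis t)) \<le> C * r ^ k)"
  have "P (-pi) pi"
  proof (rule Bolzano)
    fix a b c assume "P a b" "P b c"
    then obtain C1 C2 where
      C: "\<And>r t. r \<ge> 1 \<Longrightarrow> t \<in> {a..b} \<Longrightarrow> norm (B (of_real r * cis t)) \<le> C1 * r ^ k"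
         "\<And>r t. r \<ge> 1 \<Longrightarrow> t \<in> {b..c} \<Longrightarrow> norm (B (of_real r * cis t)) \<le> C2 * r ^ k"
      unfolding P_def by blast
    show "P a c"
      unfolding P_def
    proof (intro exI[of _ "max C1 C2"] allI impI ballI)
      fix r t :: real assume r: "r \<ge> 1" and t: "t \<in> {a..c}"
      have "C1 * r ^ k \<le> max C1 C2 * r ^ k" "C2 * r ^ k \<le> max C1 C2 * r ^ k"
        using r by (auto intro!: mult_right_mono)
      moreover have "t \<in> {a..b} \<or> t \<in> {b..c}" using t by auto
      ultimately show "norm (B (of_real r * cis t)) \<le> max C1 C2 * r ^ k"
        using C[OF r, of t] by linarith
    qed
  next
    fix x :: real
    obtain \<theta>1 \<theta>2 C where *: "\<theta>1 < x" "x < \<theta>2"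
        "\<forall>r\<ge>1. \<forall>t\<in>{\<theta>1..\<theta>2}. norm (B (of_real r * cis t)) \<le> C * r ^ k"
      using loc by blast
    show "\<exists>d>0. \<forall>a b. a \<le> x \<and> x \<le> b \<and> b - a < d \<longrightarrow> P a b"
      unfolding P_def
      by (intro exI[of _ "min (x - \<theta>1) (\<theta>2 - x)"] conjI allI impI exI[of _ C] ballI)
         (use * in auto)
  qed simp
  then obtain C where C: "\<And>r t. r \<ge> 1 \<Longrightarrow> t \<in> {-pi..pi} \<Longrightarrow> norm (B (of_real r * cis t)) \<le> C * r ^ k"
    unfolding P_def by blast
  show ?thesis
  proof (rule entire_power_bound_imp_poly[OF hol, of C k])
    fix z :: complex assume z: "norm z \<ge> 1"
    have "z = of_real (norm z) * cis (Arg z)"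
      using z by (metis rcis_cmod_Arg rcis_def)
    then show "norm (B z) \<le> C * norm z ^ k"
      using C[OF z, of "Arg z"] Arg_bounded[of z] by auto
  qed
qed

section \<open>Circles and rays avoiding small discs\<close>

text \<open>
  A Borel-Cantelli argument. At most \<open>C (2 + j)\<^sup>k\<close> points of \<open>Z\<close> have modulus in \<open>[j, j + 1)\<close>, and each
  excludes an interval of length of the order of \<open>j\<close> to the power \<open>-(k + 2)\<close>; the total length for all
  \<open>j \<ge> J\<close> is the tail of a convergent series \<open>\<Sum> D / j\<^sup>2\<close>, so it is less than \<open>\<eta>\<close> for large \<open>J\<close>. The
  threshold \<open>J\<close> depends on the length \<open>\<eta>\<close> of the window only and not on its position \<open>u\<close>; this uniformity
  is what is needed to find large radii.
\<close>

lemma exists_point_outside_thin_sets: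
  fixes Z :: "complex set" and I :: "complex \<Rightarrow> real set"
  assumes fin: "\<And>r. finite (Z \<inter> cball 0 r)"
    and card: "\<And>r. r \<ge> 0 \<Longrightarrow> real (card (Z \<inter> cball 0 r)) \<le> C * (1 + r) ^ k"
    and \<kappa>: "\<kappa> \<ge> 0"
    and I: "\<And>a. a \<in> Z \<Longrightarrow> \<exists>c. I a \<subseteq> {c - \<kappa> / (1 + norm a) ^ (k + 2) .. c + \<kappa> / (1 + norm a) ^ (k + 2)}"
    and \<eta>: "\<eta> > 0"
  obtains J :: nat where "\<And>u. \<exists>t. u < t \<and> t < u + \<eta> \<and> (\<forall>a\<in>Z. norm a \<ge> J \<longrightarrow> t \<notin> I a)"
proof -
  define \<delta> where "\<delta> = (\<lambda>a::complex. \<kappa> / (1 + norm a) ^ (k + 2))"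
  have "\<forall>a\<in>Z. \<exists>c. I a \<subseteq> {c - \<delta> a..c + \<delta> a}"
    using I by (simp add: \<delta>_def)
  then obtain c where c: "\<And>a. a \<in> Z \<Longrightarrow> I a \<subseteq> {c a - \<delta> a..c a + \<delta> a}" by metis
  \<comment> \<open>The points of \<open>Z\<close> by shells; each shell contributes the set \<open>U j\<close> of excluded points.\<close>
  define Sh where "Sh = (\<lambda>j. {a \<in> Z. real j \<le> norm a \<and> norm a < real j + 1})"
  define U where "U = (\<lambda>j. \<Union>a\<in>Sh j. {c a - \<delta> a..c a + \<delta> a})"
  have C0: "C \<ge> 0"
    using order_trans[OF of_nat_0_le_iff card[of 0]] by simp
  define D where "D = C * 2 ^ k * (2 * \<kappa>)"
  have D0: "D \<ge> 0" using C0 \<kappa> by (simp add: D_def)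
  have Sh: "finite (Sh j)" "real (card (Sh j)) \<le> C * (2 + real j) ^ k" for j
  proof -
    have sub: "Sh j \<subseteq> Z \<inter> cball 0 (real j + 1)" by (auto simp: Sh_def)
    show "finite (Sh j)" using finite_subset[OF sub fin] .
    have "real (card (Sh j)) \<le> real (card (Z \<inter> cball 0 (real j + 1)))"
      using card_mono[OF fin sub] by simp
    also have "\<dots> \<le> C * (1 + (real j + 1)) ^ k" by (rule card) simp
    finally show "real (card (Sh j)) \<le> C * (2 + real j) ^ k" by (simp add: add_ac)
  qed
  have meas: "U j \<in> sets lborel" for j
    unfolding U_def using Sh(1) by (intro sets.finite_UN) auto
  define b where "b = (\<lambda>j. D * (1 / real (Suc j) ^ 2))"
  have b0: "b j \<ge> 0" for j using D0 by (simp add: b_def)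
  have mU: "emeasure lborel (U j) \<le> ennreal (b j)" for j
  proof -
    have d: "\<delta> a \<le> \<kappa> / (1 + real j) ^ (k + 2)" "\<delta> a \<ge> 0" if "a \<in> Sh j" for a
      using that \<kappa> unfolding \<delta>_def Sh_def
      by (auto intro!: divide_left_mono power_mono mult_pos_pos zero_less_power add_pos_nonneg
          simp del: power_Suc power_add)
    have "emeasure lborel (U j) \<le> (\<Sum>a\<in>Sh j. emeasure lborel {c a - \<delta> a..c a + \<delta> a})"
      unfolding U_def using Sh(1) by (intro emeasure_subadditive_finite) auto
    also have "\<dots> = (\<Sum>a\<in>Sh j. ennreal (2 * \<delta> a))"
      using d(2) by (intro sum.cong refl) (simp add: algebra_simps)
    also have "\<dots> = ennreal (\<Sum>a\<in>Sh j. 2 * \<delta> a)"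
      using d(2) by (intro sum_ennreal) auto
    also have "(\<Sum>a\<in>Sh j. 2 * \<delta> a) \<le> real (card (Sh j)) * (2 * (\<kappa> / (1 + real j) ^ (k + 2)))"
      using d(1) by (intro sum_bounded_above mult_left_mono) auto
    also have "\<dots> \<le> C * (2 + real j) ^ k * (2 * (\<kappa> / (1 + real j) ^ (k + 2)))"
      using Sh(2)[of j] \<kappa> by (intro mult_right_mono) auto
    also have "\<dots> \<le> C * (2 * (1 + real j)) ^ k * (2 * (\<kappa> / (1 + real j) ^ (k + 2)))"
      using C0 \<kappa> by (intro mult_right_mono mult_left_mono power_mono) auto
    also have "\<dots> = D * ((1 + real j) ^ k / (1 + real j) ^ (k + 2))"
      unfolding power_mult_distrib D_def by simp
    also have "(1 + real j) ^ k / (1 + real j) ^ (k + 2) = 1 / real (Suc j) ^ 2"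
      unfolding power_add by simp
    finally show ?thesis by (simp add: b_def ennreal_leI)
  qed
  have sm: "summable b"
    unfolding b_def
  proof (rule summable_mult)
    have "summable (\<lambda>n. 1 / real n ^ 2)"
      using inverse_power_summable[of 2, where 'a = real] by (simp add: inverse_eq_divide)
    then show "summable (\<lambda>j. 1 / real (Suc j) ^ 2)"
      by (subst summable_Suc_iff)
  qed
  obtain J where J: "norm (\<Sum>j. b (j + J)) < \<eta>"
    using suminf_exist_split[OF \<eta> sm] by (meson order_refl)
  define W where "W = (\<Union>j. U (j + J))"
  have "emeasure lborel W \<le> (\<Sum>j. emeasure lborel (U (j + J)))"
    unfolding W_def using meas by (intro emeasure_subadditive_countably) auto
  also have "\<dots> \<le> (\<Sum>j. ennreal (b (j + J)))"
    by (intro suminf_le mU) auto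
  also have "\<dots> = ennreal (\<Sum>j. b (j + J))"
    by (intro suminf_ennreal2 b0 summable_ignore_initial_segment[OF sm])
  also have "\<dots> < ennreal \<eta>"
    using J \<eta> by (intro ennreal_lessI) auto
  finally have mW: "emeasure lborel W < ennreal \<eta>" .
  show thesis
  proof (rule that[of J])
    fix u :: real
    have "\<not> {u<..<u+\<eta>} \<subseteq> W"
    proof
      assume "{u<..<u+\<eta>} \<subseteq> W"
      then have "emeasure lborel {u<..<u+\<eta>} \<le> emeasure lborel W"
        using meas by (intro emeasure_mono) (auto simp: W_def)
      with mW \<eta> show False by simp
    qed
    then obtain t where "t \<in> {u<..<u+\<eta>}" and tW: "t \<notin> W" by blast
    then have t: "u < t" "t < u + \<eta>" by auto
    have "t \<notin> I a" if a: "a \<in> Z" "norm a \<ge> J" for a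
    proof
      assume "t \<in> I a"
      then have "t \<in> {c a - \<delta> a..c a + \<delta> a}" using c[OF a(1)] by blast
      moreover have "nat \<lfloor>norm a\<rfloor> \<ge> J" using a(2) by (simp add: le_nat_floor)
      moreover have "a \<in> Sh (nat \<lfloor>norm a\<rfloor>)"
        using a(1) by (simp add: Sh_def of_nat_nat)
      ultimately have "t \<in> U (nat \<lfloor>norm a\<rfloor>)" by (auto simp: U_def)
      moreover have "nat \<lfloor>norm a\<rfloor> = (nat \<lfloor>norm a\<rfloor> - J) + J"
        using \<open>nat \<lfloor>norm a\<rfloor> \<ge> J\<close> by simp
      ultimately have "t \<in> U ((nat \<lfloor>norm a\<rfloor> - J) + J)" by simp
      then have "t \<in> W" unfolding W_def by blast
      with tW show False by simp
    qed
    with t show "\<exists>t. u < t \<and> t < u + \<eta> \<and> (\<forall>a\<in>Z. norm a \<ge> J \<longrightarrow> t \<notin> I a)" by blast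
  qed
qed

lemma abs_le_two_sin:
  fixes x :: real
  assumes "\<bar>x\<bar> \<le> 1"
  shows "\<bar>x\<bar> \<le> 2 * \<bar>sin x\<bar>"
proof -
  have pos: "y \<le> 2 * sin y" if y: "0 < y" "y \<le> 1" for y :: real
  proof -
    obtain \<xi> where \<xi>: "0 < \<xi>" "\<xi> < y" "sin y - sin 0 = (y - 0) * cos \<xi>"
      using MVT2[of 0 y sin cos] y by (auto intro: DERIV_sin)
    have "cos (pi/3) \<le> cos \<xi>"
      using \<xi> y pi_gt3 by (intro cos_monotone_0_pi_le) auto
    then have "y * (1/2) \<le> y * cos \<xi>" using y by (intro mult_left_mono) (auto simp: cos_60)
    with \<xi>(3) show ?thesis by simp
  qed
  consider "x = 0" | "x > 0" | "x < 0" by linarith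
  then show ?thesis
  proof cases
    case 2
    then show ?thesis using pos[of x] assms by simp
  next
    case 3
    then have "- x \<le> 2 * sin (- x)" using pos[of "-x"] assms by simp
    then show ?thesis using 3 by (simp add: abs_if) 
  qed simp
qed

text \<open>
  A disc of radius \<open>\<delta>\<close> whose centre has modulus at least \<open>1\<close> is seen from the origin under an angle of
  the order of \<open>\<delta>\<close>.
\<close>

lemma angles_into_small_disc_close:
  assumes near: "norm (of_real r1 * cis \<theta>1 - a) < \<delta>" "norm (of_real r2 * cis \<theta>2 - a) < \<delta>"
    and r: "r1 \<ge> 0" "r2 \<ge> 0" and a: "norm a \<ge> 1" and \<theta>: "\<bar>\<theta>1 - \<theta>2\<bar> \<le> 1"
  shows "\<bar>\<theta>1 - \<theta>2\<bar> \<le> 8 * \<delta>"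
proof -
  have *: "norm (of_real (norm a) * cis \<theta> - a) < 2 * \<delta>" if "norm (of_real r * cis \<theta> - a) < \<delta>" "r \<ge> 0" for r \<theta>
  proof -
    have "\<bar>r - norm a\<bar> < \<delta>"
      using norm_triangle_ineq3[of "of_real r * cis \<theta>" a] that by (simp add: norm_mult)
    moreover have "norm (of_real (norm a) * cis \<theta> - of_real r * cis \<theta>) = \<bar>r - norm a\<bar>"
      by (simp add: left_diff_distrib[symmetric] norm_mult of_real_diff[symmetric] abs_minus_commute del: of_real_diff)
    ultimately show ?thesis
      using that(1) norm_triangle_ineq[of "of_real (norm a) * cis \<theta> - of_real r * cis \<theta>" "of_real r * cis \<theta> - a"]
      by simp
  qed
  have "norm (of_real (norm a) * cis \<theta>1 - of_real (norm a) * cis \<theta>2) < 4 * \<delta>"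
    using *[OF near(1) r(1)] *[OF near(2) r(2)]
      norm_triangle_ineq4[of "of_real (norm a) * cis \<theta>1 - a" "of_real (norm a) * cis \<theta>2 - a"] by simp
  moreover have "norm (of_real (norm a) * cis \<theta>1 - of_real (norm a) * cis \<theta>2) = norm a * norm (cis \<theta>1 - cis \<theta>2)"
    by (simp add: right_diff_distrib[symmetric] norm_mult)
  moreover have "norm (cis \<theta>1 - cis \<theta>2) \<le> norm a * norm (cis \<theta>1 - cis \<theta>2)"
    using a mult_right_mono[of 1 "norm a" "norm (cis \<theta>1 - cis \<theta>2)"] by simp
  moreover have "\<bar>sin (\<theta>1 - \<theta>2)\<bar> \<le> norm (cis \<theta>1 - cis \<theta>2)"
  proof -
    have "norm (cis \<theta>1 - cis \<theta>2) = norm (cis (- \<theta>2) * (cis \<theta>1 - cis \<theta>2))"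
      by (simp add: norm_mult)
    also have "cis (- \<theta>2) * (cis \<theta>1 - cis \<theta>2) = cis (\<theta>1 - \<theta>2) - 1"
      by (simp add: right_diff_distrib cis_mult)
    also have "norm \<dots> \<ge> \<bar>Im (cis (\<theta>1 - \<theta>2) - 1)\<bar>" by (rule abs_Im_le_cmod)
    finally show ?thesis by simp
  qed
  ultimately show ?thesis using abs_le_two_sin[OF \<theta>] by linarith
qed

text \<open>
  The radius of the disc about \<open>a\<close> is bounded by \<open>1\<close>, and in the applications \<open>q = k + 2\<close>, where the number
  of points of \<open>Z\<close> in the disc of radius \<open>r\<close> is of the order of \<open>r\<^sup>k\<close>.
\<close>

definition exceptional_discs_avoided :: "complex set \<Rightarrow> nat \<Rightarrow> complex \<Rightarrow> bool" where
  "exceptional_discs_avoided Z q z \<longleftrightarrow> (\<forall>a\<in>Z. norm (z - a) \<ge> 1 / (1 + norm a) ^ q)"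

lemma inverse_power_radius_le_1: "1 / (1 + norm (a::complex)) ^ q \<le> 1"
  by (simp add: divide_le_eq)

text \<open>
  A circle about \<open>0\<close> meets the disc about \<open>a\<close> only if its radius lies in an interval about \<open>\<bar>a\<bar>\<close>. The
  finitely many discs with centre below the threshold \<open>J\<close> stay inside the disc of radius \<open>J + 1\<close>.
\<close>

lemma exists_circle_avoiding_discs:
  fixes Z :: "complex set"
  assumes fin: "\<And>r. finite (Z \<inter> cball 0 r)"
    and card: "\<And>r. r \<ge> 0 \<Longrightarrow> real (card (Z \<inter> cball 0 r)) \<le> C * (1 + r) ^ k"
  shows "\<exists>r\<ge>X. \<forall>z. norm z = r \<longrightarrow> exceptional_discs_avoided Z (k + 2) z"
proof -
  define I where "I = (\<lambda>a::complex. {norm a - 1 / (1 + norm a) ^ (k + 2) .. norm a + 1 / (1 + norm a) ^ (k + 2)})"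
  obtain J :: nat where J: "\<And>u. \<exists>t. u < t \<and> t < u + 1 \<and> (\<forall>a\<in>Z. norm a \<ge> J \<longrightarrow> t \<notin> I a)"
    by (rule exists_point_outside_thin_sets[OF fin card, of 1 I 1])
       (auto simp: I_def intro: that)
  obtain r where r: "max X (real J + 1) < r" "\<And>a. a \<in> Z \<Longrightarrow> norm a \<ge> J \<Longrightarrow> r \<notin> I a"
    using J[of "max X (real J + 1)"] by blast
  have "exceptional_discs_avoided Z (k + 2) z" if z: "norm z = r" for z
    unfolding exceptional_discs_avoided_def
  proof
    fix a assume a: "a \<in> Z"
    have t: "\<bar>norm z - norm a\<bar> \<le> norm (z - a)" by (rule norm_triangle_ineq3)
    show "norm (z - a) \<ge> 1 / (1 + norm a) ^ (k + 2)"
    proof (cases "norm a \<ge> J")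
      case True
      then show ?thesis using r(2)[OF a True] t z by (auto simp: I_def)
    next
      case False
      then have "norm (z - a) \<ge> 1" using t z r(1) by linarith
      then show ?thesis using inverse_power_radius_le_1[of a "k + 2"] by linarith
    qed
  qed
  then show ?thesis using r(1) by (intro exI[of _ r]) auto
qed

text \<open>
  Here the thin sets consist of the directions in which the ray meets the disc about \<open>a\<close>. The
  finitely many discs that the direction may fail to avoid are left behind for large \<open>r\<close>.
\<close>

lemma exists_ray_avoiding_discs:
  fixes Z :: "complex set"
  assumes fin: "\<And>r. finite (Z \<inter> cball 0 r)"
    and card: "\<And>r. r \<ge> 0 \<Longrightarrow> real (card (Z \<inter> cball 0 r)) \<le> C * (1 + r) ^ k"
    and uv: "u < v"
  shows "\<exists>\<theta> X. u < \<theta> \<and> \<theta> < v \<and> (\<forall>r\<ge>X. exceptional_discs_avoided Z (k + 2) (of_real r * cis \<theta>))"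
proof -
  define \<eta> where "\<eta> = min 1 (v - u)"
  \<comment> \<open>Discs about points near the origin can be met in every direction, so they are left out.\<close>
  define Z' where "Z' = Z - ball 0 1"
  define I where "I = (\<lambda>a. {\<theta>. u < \<theta> \<and> \<theta> < u + \<eta> \<and> (\<exists>r\<ge>0. norm (of_real r * cis \<theta> - a) < 1 / (1 + norm a) ^ (k + 2))})"
  have fin': "finite (Z' \<inter> cball 0 r)" for r
    using fin[of r] by (rule rev_finite_subset) (auto simp: Z'_def)
  have card': "real (card (Z' \<inter> cball 0 r)) \<le> C * (1 + r) ^ k" if "r \<ge> 0" for r
  proof -
    have "card (Z' \<inter> cball 0 r) \<le> card (Z \<inter> cball 0 r)"
      by (rule card_mono[OF fin]) (auto simp: Z'_def)
    then show ?thesis using card[OF that] by linarith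
  qed
  have thin: "\<exists>c. I a \<subseteq> {c - 8 / (1 + norm a) ^ (k + 2) .. c + 8 / (1 + norm a) ^ (k + 2)}" if a: "a \<in> Z'" for a
  proof (cases "I a = {}")
    case False
    then obtain c where c: "c \<in> I a" by blast
    have "\<bar>\<theta> - c\<bar> \<le> 8 * (1 / (1 + norm a) ^ (k + 2))" if \<theta>: "\<theta> \<in> I a" for \<theta>
    proof -
      from \<theta> obtain r1 where 1: "u < \<theta>" "\<theta> < u + \<eta>" "r1 \<ge> 0" "norm (of_real r1 * cis \<theta> - a) < 1 / (1 + norm a) ^ (k + 2)"
        by (auto simp: I_def)
      from c obtain r2 where 2: "u < c" "c < u + \<eta>" "r2 \<ge> 0" "norm (of_real r2 * cis c - a) < 1 / (1 + norm a) ^ (k + 2)"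
        by (auto simp: I_def)
      show ?thesis
        by (rule angles_into_small_disc_close[OF 1(4) 2(4)]) (use 1 2 a in \<open>auto simp: \<eta>_def Z'_def\<close>)
    qed
    then show ?thesis by (intro exI[of _ c]) (auto simp: abs_le_iff field_simps)
  qed auto
  have "\<eta> > 0" using uv by (simp add: \<eta>_def)
  then obtain J :: nat where J: "\<And>u. \<exists>t. u < t \<and> t < u + \<eta> \<and> (\<forall>a\<in>Z'. norm a \<ge> J \<longrightarrow> t \<notin> I a)"
    using exists_point_outside_thin_sets[OF fin' card' _ thin, of \<eta>] by auto
  obtain \<theta> where \<theta>: "u < \<theta>" "\<theta> < u + \<eta>" "\<And>a. a \<in> Z' \<Longrightarrow> norm a \<ge> J \<Longrightarrow> \<theta> \<notin> I a"
    using J[of u] by blast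
  have "exceptional_discs_avoided Z (k + 2) (of_real r * cis \<theta>)" if r: "r \<ge> real J + 2" for r
    unfolding exceptional_discs_avoided_def
  proof
    fix a assume a: "a \<in> Z"
    show "norm (of_real r * cis \<theta> - a) \<ge> 1 / (1 + norm a) ^ (k + 2)"
    proof (cases "norm a \<ge> 1 \<and> norm a \<ge> J")
      case True
      then have "\<theta> \<notin> I a" using \<theta>(3) a by (simp add: Z'_def)
      moreover have "r \<ge> 0" using r by linarith
      ultimately show ?thesis using \<theta>(1,2) unfolding I_def not_less[symmetric] by blast
    next
      case False
      have "r - norm a \<le> norm (of_real r * cis \<theta> - a)"
        using norm_triangle_ineq2[of "of_real r * cis \<theta>" a] r by (simp add: norm_mult)
      then have "norm (of_real r * cis \<theta> - a) \<ge> 1" using False r by linarith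
      then show ?thesis using inverse_power_radius_le_1[of a "k + 2"] by linarith
    qed
  qed
  moreover have "\<theta> < v" using \<theta>(2) by (simp add: \<eta>_def)
  ultimately show ?thesis using \<theta>(1) by blast
qed

section \<open>Logarithmic derivatives of functions of finite order\<close>

text \<open>
  Finite order, phrased as one bound that is valid in the whole plane; this saves thresholds.
\<close>

definition finite_growth :: "(complex \<Rightarrow> complex) \<Rightarrow> bool" where
  "finite_growth F \<longleftrightarrow> (\<exists>C k. C \<ge> 0 \<and> (\<forall>z. norm (F z) \<le> exp (C * (1 + norm z) ^ k)))"

lemma finite_growth_deriv:
  assumes hol: "F holomorphic_on UNIV" and "finite_growth F"
  shows "finite_growth (deriv F)"
proof -
  obtain C k where C: "C \<ge> 0" "\<And>z. norm (F z) \<le> exp (C * (1 + norm z) ^ k)"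
    using assms(2) by (auto simp: finite_growth_def)
  have "norm (deriv F z) \<le> exp (C * 2 ^ k * (1 + norm z) ^ k)" for z
  proof -
    have "norm ((deriv ^^ 1) F z) \<le> fact 1 * exp (C * 2 ^ k * (1 + norm z) ^ k) / 1 ^ 1"
    proof (rule Cauchy_inequality)
      show "F holomorphic_on ball z 1" "continuous_on (cball z 1) F"
        using hol holomorphic_on_subset holomorphic_on_imp_continuous_on by blast+
      fix x :: complex assume x: "norm (z - x) = 1"
      have "1 + norm x \<le> 2 * (1 + norm z)"
      proof -
        have "norm x \<le> norm z + 1"
          using norm_triangle_ineq2[of x z] x by (simp add: norm_minus_commute)
        moreover have "0 \<le> norm z" by simp
        ultimately show ?thesis by argo
      qed
      then have "C * (1 + norm x) ^ k \<le> C * (2 * (1 + norm z)) ^ k"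
        using C(1) by (intro mult_left_mono power_mono) auto
      then have "exp (C * (1 + norm x) ^ k) \<le> exp (C * 2 ^ k * (1 + norm z) ^ k)"
        unfolding power_mult_distrib by (simp only: exp_le_cancel_iff mult.assoc)
      with C(2)[of x] show "norm (F x) \<le> exp (C * 2 ^ k * (1 + norm z) ^ k)"
        by (rule order_trans)
    qed simp
    then show ?thesis by simp
  qed
  then show ?thesis unfolding finite_growth_def using C(1)
    by (intro exI[of _ "C * 2 ^ k"] exI[of _ k]) auto
qed

text \<open>
  The bound for the zeros in a disc about \<open>w\<close>, a point where \<open>F\<close> does not vanish, that contains the disc
  of radius \<open>r\<close> about \<open>0\<close>.
\<close>

lemma finite_growth_zeros_card:
  assumes hol: "F holomorphic_on UNIV" and "finite_growth F" and Fw: "F w \<noteq> 0"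
  shows "\<exists>C k. C \<ge> 0 \<and> (\<forall>r\<ge>0. real (card {z \<in> cball 0 r. F z = 0}) \<le> C * (1 + r) ^ k)"
proof -
  obtain C k where C: "C \<ge> 0" "\<And>z. norm (F z) \<le> exp (C * (1 + norm z) ^ k)"
    using assms(2) by (auto simp: finite_growth_def)
  define E where "E = 4 + 4 * norm w"
  define l where "l = \<bar>ln (norm (F w))\<bar>"
  have "real (card {z \<in> cball 0 r. F z = 0}) \<le> 2 * (C * E ^ k + l) * (1 + r) ^ k" if r: "r \<ge> 0" for r
  proof -
    define R where "R = 3 * (r + norm w) + 3"
    define M where "M = C * (1 + norm w + R) ^ k"
    have R: "R > 0" using r unfolding R_def by (simp add: add_nonneg_pos)
    have bd: "norm (F z) \<le> exp M" if "z \<in> cball w R" for z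
    proof -
      have "norm z \<le> norm w + R"
        using that norm_triangle_ineq2[of z w] by (simp add: dist_norm norm_minus_commute)
      then have "C * (1 + norm z) ^ k \<le> M"
        unfolding M_def using C(1) by (intro mult_left_mono power_mono) auto
      then show ?thesis using C(2)[of z] by (meson exp_le_cancel_iff order_trans)
    qed
    have "cball 0 r \<subseteq> cball w (R/3)"
    proof
      fix x :: complex assume "x \<in> cball 0 r"
      then show "x \<in> cball w (R/3)"
        using norm_triangle_ineq4[of w x] by (simp add: R_def dist_norm)
    qed
    then have sub: "{z \<in> cball 0 r. F z = 0} \<subseteq> {z \<in> cball w (R/3). F z = 0}" by blast
    have "finite {z \<in> cball w (R/3). F z = 0}"
      by (rule entire_not_constant_zeros_finite[OF hol]) (use Fw in auto)
    then have "real (card {z \<in> cball 0 r. F z = 0}) \<le> real (card {z \<in> cball w (R/3). F z = 0})"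
      using sub by (simp add: card_mono)
    also have "\<dots> \<le> 2 * (M - ln (norm (F w)))"
      by (rule entire_zeros_card_bound[OF hol Fw R bd])
    also have "\<dots> \<le> 2 * (C * (E * (1 + r)) ^ k + l * (1 + r) ^ k)"
    proof -
      have "1 + norm w + R \<le> E * (1 + r)"
        using r mult_nonneg_nonneg[OF norm_ge_zero r, of w] by (simp add: R_def E_def algebra_simps)
      then have "M \<le> C * (E * (1 + r)) ^ k"
        unfolding M_def using C(1) R by (intro mult_left_mono power_mono) auto
      moreover have "l * 1 \<le> l * (1 + r) ^ k" using r by (intro mult_left_mono) (auto simp: l_def)
      moreover have "- ln (norm (F w)) \<le> l" by (simp add: l_def)
      ultimately show ?thesis by simp
    qed
    also have "\<dots> = 2 * (C * E ^ k + l) * (1 + r) ^ k"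
      unfolding power_mult_distrib by (simp add: algebra_simps)
    finally show ?thesis .
  qed
  moreover have "2 * (C * E ^ k + l) \<ge> 0" using C(1) by (simp add: E_def l_def)
  ultimately show ?thesis by blast
qed

text \<open>
  The local estimate on a disc about \<open>w\<close> whose radius is proportional to \<open>\<bar>z\<bar>\<close>: there \<open>L\<close> is a power of
  \<open>\<bar>z\<bar>\<close> by finite order, and \<open>1/\<delta>\<close> is one because the exceptional discs shrink only polynomially.
\<close>

lemma finite_growth_log_deriv_bound:
  assumes hol: "F holomorphic_on UNIV" and "finite_growth F" and Fw: "F w \<noteq> 0"
  shows "\<exists>c X. \<forall>z. norm z \<ge> X \<longrightarrow> exceptional_discs_avoided {a. F a = 0} q z \<longrightarrow>
           norm (deriv F z / F z) \<le> norm z ^ c"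
proof -
  obtain C k where C: "C \<ge> 0" "\<And>z. norm (F z) \<le> exp (C * (1 + norm z) ^ k)"
    using assms(2) by (auto simp: finite_growth_def)
  \<comment> \<open>\<open>E\<close> is chosen such that \<open>1 + \<bar>w\<bar> + R \<le> E \<bar>z\<bar>\<close> for the radius \<open>R\<close> below.\<close>
  define E where "E = 25 + 13 * norm w"
  define l where "l = \<bar>ln (norm (F w))\<bar>"
  define D where "D = (6 * (C + l) + 4) * E ^ (k + q)"
  have l0: "l \<ge> 0" by (simp add: l_def)
  have main: "norm (deriv F z / F z) \<le> norm z ^ (k + q + 1)"
    if z: "norm z \<ge> max 1 D" and av: "exceptional_discs_avoided {a. F a = 0} q z" for z
  proof -
    define R where "R = 12 * (norm z + norm w + 1)"
    define T where "T = 1 + norm w + R"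
    define M where "M = C * T ^ k"
    define L where "L = (C + l) * T ^ k"
    have R12: "R \<ge> 12" by (simp add: R_def)
    have T1: "T \<ge> 1" using R12 by (simp add: T_def)
    have TE: "T \<le> E * norm z"
    proof -
      have "norm w * 1 \<le> norm w * norm z" using z by (intro mult_left_mono) auto
      then show ?thesis using z by (simp add: T_def R_def E_def algebra_simps)
    qed
    have bd: "norm (F y) \<le> exp M" if "y \<in> cball w R" for y
    proof -
      have "norm y \<le> norm w + R"
        using that norm_triangle_ineq2[of y w] by (simp add: dist_norm norm_minus_commute)
      then have "C * (1 + norm y) ^ k \<le> M"
        unfolding M_def T_def using C(1) by (intro mult_left_mono power_mono) auto
      then show ?thesis using C(2)[of y] by (meson exp_le_cancel_iff order_trans)
    qed
    have far: "norm (z - a) \<ge> 1 / T ^ q" if "F a = 0" "a \<in> cball w (R/3)" for a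
    proof -
      have "norm a \<le> norm w + R"
        using that(2) norm_triangle_ineq2[of a w] R12 by (simp add: dist_norm norm_minus_commute)
      then have "1 / T ^ q \<le> 1 / (1 + norm a) ^ q"
        using T1 by (intro divide_left_mono power_mono mult_pos_pos zero_less_power)
          (auto simp: T_def intro: add_pos_nonneg)
      also have "\<dots> \<le> norm (z - a)" using av that(1) by (simp add: exceptional_discs_avoided_def)
      finally show ?thesis .
    qed
    have M_le_L: "M - ln (norm (F w)) \<le> L"
    proof -
      have "l * 1 \<le> l * T ^ k" using T1 l0 by (intro mult_left_mono) auto
      then have "M + l \<le> L" by (simp add: M_def L_def algebra_simps)
      then show ?thesis by (simp add: l_def)
    qed
    have L0: "L \<ge> 0" using C(1) l0 T1 by (simp add: L_def)
    have "norm (deriv F z / F z) \<le> 48 * (L + 1) / R + 2 * L / (1 / T ^ q)"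
    proof (rule entire_log_deriv_bound[OF hol Fw _ bd M_le_L])
      show "z \<in> ball w (R / 12)"
        using norm_triangle_ineq4[of w z] by (simp add: R_def dist_norm)
      show "R > 0" "1 / T ^ q > 0" using R12 T1 by auto
    qed (use far in auto)
    also have "\<dots> = 48 * (L + 1) / R + 2 * L * T ^ q" by simp
    also have "48 * (L + 1) / R \<le> 48 * (L + 1) / 12"
      using R12 L0 by (intro divide_left_mono) auto
    also have "48 * (L + 1) / 12 + 2 * L * T ^ q = 4 * L + 4 + 2 * L * T ^ q" by simp
    also have "\<dots> \<le> (6 * L + 4) * T ^ q"
    proof -
      have "(4 * L + 4) * 1 \<le> (4 * L + 4) * T ^ q" using L0 T1 by (intro mult_left_mono) auto
      then show ?thesis by (simp add: algebra_simps)
    qed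
    also have "\<dots> \<le> ((6 * (C + l) + 4) * T ^ k) * T ^ q"
      using T1 by (intro mult_right_mono) (auto simp: L_def algebra_simps)
    also have "\<dots> = (6 * (C + l) + 4) * T ^ (k + q)" by (simp add: power_add)
    also have "\<dots> \<le> (6 * (C + l) + 4) * (E * norm z) ^ (k + q)"
      using T1 TE C(1) l0 by (intro mult_left_mono power_mono) auto
    also have "\<dots> = D * norm z ^ (k + q)" by (simp add: D_def power_mult_distrib)
    also have "\<dots> \<le> norm z * norm z ^ (k + q)" using z by (intro mult_right_mono) auto
    finally show ?thesis by simp
  qed
  then show ?thesis by blast
qed

text \<open>
  Applies the previous bound to \<open>f\<close> and to \<open>f'\<close>, using \<open>f''/f = (f''/f') (f'/f)\<close>, with a common family of
  exceptional discs about the zeros of both functions.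
\<close>

lemma finite_growth_second_log_derivs:
  assumes hol: "f holomorphic_on UNIV" and fg: "finite_growth f" and nc: "deriv f w \<noteq> 0"
  obtains c where
    "\<And>X. \<exists>r\<ge>X. \<forall>z. norm z = r \<longrightarrow> f z \<noteq> 0 \<and> norm (deriv f z) \<le> norm z ^ c * norm (f z)
        \<and> norm (deriv (deriv f) z) \<le> norm z ^ c * norm (f z)"
    "\<And>u v. u < v \<Longrightarrow> \<exists>\<theta> X. u < \<theta> \<and> \<theta> < v \<and> (\<forall>r\<ge>X. \<forall>z. z = of_real r * cis \<theta> \<longrightarrow>
        f z \<noteq> 0 \<and> norm (deriv f z) \<le> norm z ^ c * norm (f z)
        \<and> norm (deriv (deriv f) z) \<le> norm z ^ c * norm (f z))"
proof -
  have hol': "deriv f holomorphic_on UNIV" by (intro holomorphic_deriv hol) auto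
  have fg': "finite_growth (deriv f)" by (rule finite_growth_deriv[OF hol fg])
  have "\<exists>w. f w \<noteq> 0"
  proof (rule ccontr)
    assume "\<not> (\<exists>w. f w \<noteq> 0)"
    then have "f = (\<lambda>_. 0)" by auto
    with nc show False by simp
  qed
  then obtain w' where w': "f w' \<noteq> 0" by blast
  obtain C1 k1 where 1: "C1 \<ge> 0" "\<And>r. r \<ge> 0 \<Longrightarrow> real (card {z \<in> cball 0 r. f z = 0}) \<le> C1 * (1 + r) ^ k1"
    using finite_growth_zeros_card[OF hol fg w'] by blast
  obtain C2 k2 where 2: "C2 \<ge> 0" "\<And>r. r \<ge> 0 \<Longrightarrow> real (card {z \<in> cball 0 r. deriv f z = 0}) \<le> C2 * (1 + r) ^ k2"
    using finite_growth_zeros_card[OF hol' fg' nc] by blast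
  define Z where "Z = {z. f z = 0} \<union> {z. deriv f z = 0}"
  define k where "k = max k1 k2"
  have Zeq: "Z \<inter> cball 0 r = {z \<in> cball 0 r. f z = 0} \<union> {z \<in> cball 0 r. deriv f z = 0}" for r
    by (auto simp: Z_def)
  have fin: "finite (Z \<inter> cball 0 r)" for r
    unfolding Zeq using w' nc
    by (intro finite_UnI entire_not_constant_zeros_finite[OF hol] entire_not_constant_zeros_finite[OF hol']) auto
  have card: "real (card (Z \<inter> cball 0 r)) \<le> (C1 + C2) * (1 + r) ^ k" if r: "r \<ge> 0" for r
  proof -
    have "real (card (Z \<inter> cball 0 r)) \<le> real (card {z \<in> cball 0 r. f z = 0}) + real (card {z \<in> cball 0 r. deriv f z = 0})"
      unfolding Zeq of_nat_add[symmetric] of_nat_le_iff by (rule card_Un_le)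
    also have "\<dots> \<le> C1 * (1 + r) ^ k1 + C2 * (1 + r) ^ k2"
      using 1(2)[OF r] 2(2)[OF r] by simp
    also have "\<dots> \<le> C1 * (1 + r) ^ k + C2 * (1 + r) ^ k"
      using r 1(1) 2(1) by (intro add_mono mult_left_mono power_increasing) (auto simp: k_def)
    finally show ?thesis by (simp add: algebra_simps)
  qed
  define q where "q = k + 2"
  obtain c1 X1 where a1: "\<And>z. norm z \<ge> X1 \<Longrightarrow> exceptional_discs_avoided {a. f a = 0} q z \<Longrightarrow>
           norm (deriv f z / f z) \<le> norm z ^ c1"
    using finite_growth_log_deriv_bound[OF hol fg w'] by blast
  obtain c2 X2 where a2: "\<And>z. norm z \<ge> X2 \<Longrightarrow> exceptional_discs_avoided {a. deriv f a = 0} q z \<Longrightarrow>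
           norm (deriv (deriv f) z / deriv f z) \<le> norm z ^ c2"
    using finite_growth_log_deriv_bound[OF hol' fg' nc] by blast
  define X0 where "X0 = max 1 (max X1 X2)"
  define P where "P = (\<lambda>z. f z \<noteq> 0 \<and> norm (deriv f z) \<le> norm z ^ (c1 + c2) * norm (f z)
        \<and> norm (deriv (deriv f) z) \<le> norm z ^ (c1 + c2) * norm (f z))"
  have P: "P z" if z: "norm z \<ge> X0" and av: "exceptional_discs_avoided Z q z" for z
  proof -
    have z1: "norm z \<ge> 1" using z by (simp add: X0_def)
    have nz: "z \<notin> Z"
    proof
      assume "z \<in> Z"
      then have "1 / (1 + norm z) ^ q \<le> norm (z - z)"
        using av unfolding exceptional_discs_avoided_def by blast
      moreover have "1 / (1 + norm z) ^ q > 0" by (intro divide_pos_pos zero_less_power) (auto intro: add_pos_nonneg)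
      ultimately show False by simp
    qed
    then have f0: "f z \<noteq> 0" "deriv f z \<noteq> 0" by (auto simp: Z_def)
    have "norm (deriv f z / f z) \<le> norm z ^ c1"
      by (rule a1) (use z av in \<open>auto simp: X0_def exceptional_discs_avoided_def Z_def\<close>)
    then have d1: "norm (deriv f z) \<le> norm z ^ c1 * norm (f z)"
      using f0 by (simp add: norm_divide divide_le_eq)
    have "norm (deriv (deriv f) z / deriv f z) \<le> norm z ^ c2"
      by (rule a2) (use z av in \<open>auto simp: X0_def exceptional_discs_avoided_def Z_def\<close>)
    then have "norm (deriv (deriv f) z) \<le> norm z ^ c2 * norm (deriv f z)"
      using f0 by (simp add: norm_divide divide_le_eq)
    also have "\<dots> \<le> norm z ^ c2 * (norm z ^ c1 * norm (f z))"
      using d1 by (intro mult_left_mono) auto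
    finally have d2: "norm (deriv (deriv f) z) \<le> norm z ^ (c1 + c2) * norm (f z)"
      by (simp add: power_add mult_ac)
    have "norm z ^ c1 * norm (f z) \<le> norm z ^ (c1 + c2) * norm (f z)"
      using z1 by (intro mult_right_mono power_increasing) auto
    then have "norm (deriv f z) \<le> norm z ^ (c1 + c2) * norm (f z)"
      using d1 by linarith
    with d2 f0 show ?thesis by (simp add: P_def)
  qed
  have circ: "\<exists>r\<ge>X. \<forall>z. norm z = r \<longrightarrow> P z" for X
  proof -
    obtain r where "r \<ge> max X X0" "\<And>z. norm z = r \<Longrightarrow> exceptional_discs_avoided Z q z"
      using exists_circle_avoiding_discs[OF fin card, of "max X X0"] unfolding q_def by blast
    then show ?thesis
      using P by (intro exI[of _ r]) auto
  qed
  have ray: "\<exists>\<theta> X. u < \<theta> \<and> \<theta> < v \<and> (\<forall>r\<ge>X. \<forall>z. z = of_real r * cis \<theta> \<longrightarrow> P z)"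
    if "u < v" for u v
  proof -
    obtain \<theta> X where "u < \<theta>" "\<theta> < v" "\<And>r. r \<ge> X \<Longrightarrow> exceptional_discs_avoided Z q (of_real r * cis \<theta>)"
      using exists_ray_avoiding_discs[OF fin card \<open>u < v\<close>] unfolding q_def by blast
    then show ?thesis
      using P by (intro exI[of _ \<theta>] exI[of _ "max X (max 0 X0)"]) (auto simp: norm_mult)
  qed
  show thesis
    by (rule that[of "c1 + c2"]) (use circ ray in \<open>auto simp: P_def\<close>)
qed

section \<open>Canonical products\<close>

text \<open>
  A global bound with a real exponent. Contrary to a bound on the order it loses no \<open>\<epsilon>\<close>, and the
  class is closed under products.
\<close>

definition growth_at_most :: "real \<Rightarrow> (complex \<Rightarrow> complex) \<Rightarrow> bool" where
  "growth_at_most \<alpha> F \<longleftrightarrow> (\<exists>C\<ge>0. \<forall>z. norm (F z) \<le> exp (C * (1 + norm z) powr \<alpha>))"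

lemma growth_at_most_mult:
  assumes "growth_at_most \<alpha> F" "growth_at_most \<alpha> G"
  shows "growth_at_most \<alpha> (\<lambda>z. F z * G z)"
proof -
  obtain C D where C: "C \<ge> 0" "\<And>z. norm (F z) \<le> exp (C * (1 + norm z) powr \<alpha>)"
    and D: "D \<ge> 0" "\<And>z. norm (G z) \<le> exp (D * (1 + norm z) powr \<alpha>)"
    using assms by (auto simp: growth_at_most_def)
  have "norm (F z * G z) \<le> exp ((C + D) * (1 + norm z) powr \<alpha>)" for z
    unfolding norm_mult distrib_right exp_add by (intro mult_mono C D) auto
  then show ?thesis unfolding growth_at_most_def using C(1) D(1)
    by (intro exI[of _ "C + D"]) auto
qed

lemma growth_at_most_1: "growth_at_most \<alpha> (\<lambda>_. 1)"
  unfolding growth_at_most_def by (intro exI[of _ 0]) auto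

lemma growth_at_most_power:
  assumes "growth_at_most \<alpha> F"
  shows "growth_at_most \<alpha> (\<lambda>z. F z ^ n)"
  by (induction n) (auto intro: growth_at_most_1 growth_at_most_mult assms)

lemma growth_at_most_prod:
  assumes "\<And>i. i \<in> S \<Longrightarrow> growth_at_most \<alpha> (F i)"
  shows "growth_at_most \<alpha> (\<lambda>z. \<Prod>i\<in>S. F i z)"
  using assms
  by (induction S rule: infinite_finite_induct) (auto intro: growth_at_most_1 growth_at_most_mult)

lemma growth_at_most_linear:
  assumes \<alpha>: "\<alpha> > 0"
  shows "growth_at_most \<alpha> (\<lambda>z. z - a)"
proof -
  define C where "C = ln (1 + norm a) + 1 / \<alpha>"
  have C0: "C \<ge> 0" using \<alpha> by (simp add: C_def)
  have "norm (z - a) \<le> exp (C * (1 + norm z) powr \<alpha>)" for z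
  proof (cases "z = a")
    case False
    have p: "(1 + norm z) powr \<alpha> \<ge> 1" using \<alpha> by (intro ge_one_powr_ge_zero) auto
    have "norm (z - a) \<le> (1 + norm a) * (1 + norm z)"
      using norm_triangle_ineq4[of z a] mult_nonneg_nonneg[OF norm_ge_zero[of a] norm_ge_zero[of z]]
      unfolding distrib_left distrib_right by linarith
    also have "\<dots> = exp (ln (1 + norm a) + ln (1 + norm z))"
      by (simp add: exp_add add_pos_nonneg)
    also have "\<dots> \<le> exp (C * (1 + norm z) powr \<alpha>)"
    proof -
      have "ln (1 + norm z) \<le> (1 + norm z) powr \<alpha> / \<alpha>" using \<alpha> by (intro ln_powr_bound) auto
      moreover have "ln (1 + norm a) * 1 \<le> ln (1 + norm a) * (1 + norm z) powr \<alpha>"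
        using p by (intro mult_left_mono) auto
      ultimately show ?thesis by (simp add: C_def algebra_simps)
    qed
    finally show ?thesis .
  qed auto
  with C0 show ?thesis unfolding growth_at_most_def by blast
qed

text \<open>
  For small \<open>u\<close> the elementary factor differs from \<open>1\<close> by \<open>O(\<bar>u\<bar>\<^sup>p\<^sup>+\<^sup>1)\<close>, and for large \<open>u\<close> it is at most
  \<open>exp (O(\<bar>u\<bar>\<^sup>p) + ln (1 + \<bar>u\<bar>))\<close>. An exponent \<open>\<alpha>\<close> between \<open>p\<close> and \<open>p + 1\<close> serves for both.
\<close>

lemma norm_weierstrass_factor_le:
  assumes \<alpha>: "real p < \<alpha>" "\<alpha> \<le> real (Suc p)"
  shows "norm (weierstrass_factor p u) \<le> exp (max 3 (3 powr \<alpha> / \<alpha> + real p * 2 powr \<alpha>) * norm u powr \<alpha>)"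
proof (cases "norm u \<le> 1/2")
  case True
  show ?thesis
  proof (cases "u = 0")
    case False
    have "norm (weierstrass_factor p u) \<le> 1 + norm (weierstrass_factor p u - 1)"
      using norm_triangle_ineq[of 1 "weierstrass_factor p u - 1"] by simp
    also have "\<dots> \<le> 1 + 3 * norm u ^ Suc p" using weierstrass_factor_bound[OF True, of p] by simp
    also have "\<dots> \<le> exp (3 * norm u ^ Suc p)" by (rule exp_ge_add_one_self)
    also have "norm u ^ Suc p = norm u powr real (Suc p)" using False by (subst powr_realpow) auto
    also have "exp (3 * norm u powr real (Suc p)) \<le> exp (3 * norm u powr \<alpha>)"
      using \<alpha>(2) True False by (auto intro!: powr_mono')
    also have "\<dots> \<le> exp (max 3 (3 powr \<alpha> / \<alpha> + real p * 2 powr \<alpha>) * norm u powr \<alpha>)"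
      by (simp only: exp_le_cancel_iff) (intro mult_right_mono, auto)
    finally show ?thesis .
  qed simp
next
  case False
  have a0: "\<alpha> > 0" using \<alpha>(1) by linarith
  have u: "norm u > 1/2" using False by simp
  have "norm (1 - u) \<le> 1 + norm u" using norm_triangle_ineq4[of 1 u] by simp
  also have "\<dots> = exp (ln (1 + norm u))" by (simp add: add_pos_nonneg)
  also have "ln (1 + norm u) \<le> (1 + norm u) powr \<alpha> / \<alpha>" using a0 by (intro ln_powr_bound) auto
  also have "\<dots> \<le> (3 * norm u) powr \<alpha> / \<alpha>" using u a0 by (intro divide_right_mono powr_mono2) auto
  also have "\<dots> = 3 powr \<alpha> / \<alpha> * norm u powr \<alpha>" by (simp add: powr_mult)
  finally have 1: "norm (1 - u) \<le> exp (3 powr \<alpha> / \<alpha> * norm u powr \<alpha>)" by simp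
  have "norm (exp (\<Sum>k=1..p. u ^ k / of_nat k)) \<le> exp (norm (\<Sum>k=1..p. u ^ k / of_nat k))"
    by (rule norm_exp)
  also have "norm (\<Sum>k=1..p. u ^ k / of_nat k) \<le> (\<Sum>k=1..p. 2 powr \<alpha> * norm u powr \<alpha>)"
  proof (rule sum_norm_le)
    fix k assume k: "k \<in> {1..p}"
    have "norm (u ^ k / of_nat k) \<le> norm u ^ k / 1"
      unfolding norm_divide norm_power norm_of_nat using k by (intro divide_left_mono) auto
    also have "\<dots> \<le> (2 * norm u) ^ k" using power_mono[of "norm u" "2 * norm u" k] by simp
    also have "\<dots> = (2 * norm u) powr real k" using u by (subst powr_realpow) auto
    also have "\<dots> \<le> (2 * norm u) powr \<alpha>" using u k \<alpha>(1) by (intro powr_mono) auto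
    also have "\<dots> = 2 powr \<alpha> * norm u powr \<alpha>" by (simp add: powr_mult)
    finally show "norm (u ^ k / of_nat k) \<le> 2 powr \<alpha> * norm u powr \<alpha>" .
  qed
  also have "\<dots> = real p * 2 powr \<alpha> * norm u powr \<alpha>" by simp
  finally have 2: "norm (exp (\<Sum>k=1..p. u ^ k / of_nat k)) \<le> exp (real p * 2 powr \<alpha> * norm u powr \<alpha>)" by simp
  have "norm (weierstrass_factor p u) \<le> exp (3 powr \<alpha> / \<alpha> * norm u powr \<alpha>) * exp (real p * 2 powr \<alpha> * norm u powr \<alpha>)"
    unfolding weierstrass_factor_def norm_mult using 1 2 by (intro mult_mono) auto
  also have "\<dots> = exp ((3 powr \<alpha> / \<alpha> + real p * 2 powr \<alpha>) * norm u powr \<alpha>)"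
    by (simp add: exp_add[symmetric] distrib_right)
  also have "\<dots> \<le> exp (max 3 (3 powr \<alpha> / \<alpha> + real p * 2 powr \<alpha>) * norm u powr \<alpha>)"
    by (simp only: exp_le_cancel_iff) (intro mult_right_mono, auto)
  finally show ?thesis .
qed

text \<open>
  With \<open>p < \<alpha> \<le> p + 1\<close> the product of elementary factors of genus \<open>p\<close> converges, and multiplying the
  bounds for the factors gives the exponent \<open>K \<bar>z\<bar>\<^sup>\<alpha> \<Sum> \<bar>a n\<bar>\<^sup>-\<^sup>\<alpha>\<close>.
\<close>

lemma canonical_product_exists:
  fixes a :: "nat \<Rightarrow> complex"
  assumes a0: "\<And>n. a n \<noteq> 0" and lim: "filterlim a at_infinity at_top"
    and \<alpha>: "\<alpha> > 0" and sm: "summable (\<lambda>n. norm (a n) powr (- \<alpha>))"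
  obtains v where "v holomorphic_on UNIV" "\<And>z. v z = 0 \<longleftrightarrow> z \<in> range a"
    "\<And>z. zorder v z = card (a -` {z})" "growth_at_most \<alpha> v"
proof -
  define p where "p = nat \<lceil>\<alpha>\<rceil> - 1"
  have p: "real p < \<alpha>" "\<alpha> \<le> real (Suc p)"
    using \<alpha> unfolding p_def by linarith+
  interpret W: weierstrass_product a "\<lambda>_. p"
  proof
    fix r :: real assume r: "r > 0"
    have ev: "eventually (\<lambda>n. norm (a n) \<ge> 1) at_top"
      using lim by (metis filterlim_at_infinity_imp_norm_at_top filterlim_at_top)
    show "summable (\<lambda>n. (r / norm (a n)) ^ Suc p)"
    proof (rule summable_comparison_test_ev)
      show "summable (\<lambda>n. r ^ Suc p * norm (a n) powr (- \<alpha>))"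
        by (intro summable_mult sm)
      show "\<forall>\<^sub>F n in sequentially. norm ((r / norm (a n)) ^ Suc p) \<le> r ^ Suc p * norm (a n) powr (- \<alpha>)"
        using ev
      proof eventually_elim
        case (elim n)
        have "norm (a n) powr \<alpha> \<le> norm (a n) powr real (Suc p)"
          using elim p(2) by (intro powr_mono) auto
        also have "\<dots> = norm (a n) ^ Suc p" using a0[of n] by (subst powr_realpow) auto
        finally have "inverse (norm (a n) ^ Suc p) \<le> inverse (norm (a n) powr \<alpha>)"
          using a0[of n] by (intro le_imp_inverse_le) auto
        then have "r ^ Suc p * inverse (norm (a n) ^ Suc p) \<le> r ^ Suc p * inverse (norm (a n) powr \<alpha>)"
          using r by (intro mult_left_mono) auto
        then show ?case
          using r unfolding power_divide divide_inverse powr_minus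
          by (simp del: power_Suc add: power_mult_distrib power_inverse)
      qed
    qed
  qed (fact a0, fact lim)
  define K where "K = max 3 (3 powr \<alpha> / \<alpha> + real p * 2 powr \<alpha>)"
  have K0: "K \<ge> 0" by (simp add: K_def)
  define S where "S = (\<Sum>n. norm (a n) powr (- \<alpha>))"
  have S0: "S \<ge> 0" unfolding S_def by (intro suminf_nonneg sm) auto
  have "norm (W.f z) \<le> exp (K * S * (1 + norm z) powr \<alpha>)" for z
  proof -
    have part: "norm (\<Prod>i\<le>n. weierstrass_factor p (z / a i)) \<le> exp (K * S * norm z powr \<alpha>)" for n
    proof -
      have "norm (\<Prod>i\<le>n. weierstrass_factor p (z / a i)) = (\<Prod>i\<le>n. norm (weierstrass_factor p (z / a i)))"
        by (simp add: prod_norm)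
      also have "\<dots> \<le> (\<Prod>i\<le>n. exp (K * norm (z / a i) powr \<alpha>))"
        unfolding K_def by (intro prod_mono conjI norm_weierstrass_factor_le p) auto
      also have "\<dots> = exp (\<Sum>i\<le>n. K * norm z powr \<alpha> * norm (a i) powr (- \<alpha>))"
        by (simp add: exp_sum norm_divide powr_divide powr_minus_divide)
      also have "\<dots> = exp (K * norm z powr \<alpha> * (\<Sum>i\<le>n. norm (a i) powr (- \<alpha>)))"
        by (simp add: sum_distrib_left)
      also have "\<dots> \<le> exp (K * norm z powr \<alpha> * S)"
        unfolding exp_le_cancel_iff S_def
        using K0 sm by (intro mult_left_mono sum_le_suminf) auto
      finally show ?thesis by (simp add: mult_ac)
    qed
    have "(\<lambda>n. \<Prod>i\<le>n. weierstrass_factor p (z / a i)) \<longlonglongrightarrow> W.f z"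
      unfolding W.f_def by (rule convergent_prod_LIMSEQ[OF W.convergent])
    then have "(\<lambda>n. norm (\<Prod>i\<le>n. weierstrass_factor p (z / a i))) \<longlonglongrightarrow> norm (W.f z)"
      by (rule tendsto_norm)
    then have "norm (W.f z) \<le> exp (K * S * norm z powr \<alpha>)"
      by (rule LIMSEQ_le_const2) (use part in auto)
    also have "\<dots> \<le> exp (K * S * (1 + norm z) powr \<alpha>)"
      unfolding exp_le_cancel_iff using K0 S0 \<alpha> by (intro mult_left_mono powr_mono2) auto
    finally show ?thesis .
  qed
  then have "growth_at_most \<alpha> W.f"
    unfolding growth_at_most_def using K0 S0 by (intro exI[of _ "K * S"]) auto
  then show thesis
    by (intro that[of W.f] W.holomorphic W.zero W.zorder)
qed

text \<open>
  Passes from a sum over the zeros weighted by their multiplicities to a sum over a sequence that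
  repeats each zero accordingly.
\<close>

lemma summable_over_fibres:
  fixes a :: "nat \<Rightarrow> 'a" and \<phi> :: "'a \<Rightarrow> real"
  assumes fib: "\<And>z. z \<in> N \<Longrightarrow> finite (a -` {z}) \<and> real (card (a -` {z})) \<le> m z"
    and ran: "range a \<subseteq> N" and \<phi>: "\<And>z. \<phi> z \<ge> 0" 
    and sm: "(\<lambda>z. m z * \<phi> z) summable_on N"
  shows "summable (\<lambda>n. \<phi> (a n))"
proof (rule summableI_nonneg_bounded)
  fix n
  show "\<phi> (a n) \<ge> 0" by (rule \<phi>)
  have m0: "m z \<ge> 0" if "z \<in> N" for z using fib[OF that] of_nat_0_le_iff order_trans by blast
  have "(\<Sum>i<n. \<phi> (a i)) = (\<Sum>z\<in>a ` {..<n}. \<Sum>i | i \<in> {..<n} \<and> a i = z. \<phi> (a i))"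
    by (rule sum.image_gen) simp
  also have "\<dots> \<le> (\<Sum>z\<in>a ` {..<n}. m z * \<phi> z)"
  proof (rule sum_mono)
    fix z assume "z \<in> a ` {..<n}"
    then have z: "z \<in> N" using ran by auto
    have "(\<Sum>i | i \<in> {..<n} \<and> a i = z. \<phi> (a i)) = (\<Sum>i | i \<in> {..<n} \<and> a i = z. \<phi> z)"
      by (intro sum.cong) auto
    also have "\<dots> = real (card {i. i \<in> {..<n} \<and> a i = z}) * \<phi> z" by simp
    also have "\<dots> \<le> m z * \<phi> z"
    proof (rule mult_right_mono[OF _ \<phi>])
      have "card {i. i \<in> {..<n} \<and> a i = z} \<le> card (a -` {z})"
        by (rule card_mono) (use fib[OF z] in auto)
      then show "real (card {i. i \<in> {..<n} \<and> a i = z}) \<le> m z" using fib[OF z] by linarith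
    qed
    finally show "(\<Sum>i | i \<in> {..<n} \<and> a i = z. \<phi> (a i)) \<le> m z * \<phi> z" .
  qed
  also have "\<dots> \<le> infsum (\<lambda>z. m z * \<phi> z) N"
    by (rule finite_sum_le_infsum[OF sm]) (use ran m0 \<phi> in auto)
  finally show "(\<Sum>i<n. \<phi> (a i)) \<le> infsum (\<lambda>z. m z * \<phi> z) N" .
qed

text \<open>
  The part of Hadamard's factorization theorem that concerns the zeros: \<open>v\<close> carries the zeros of \<open>A\<close> and
  its growth is governed by their exponent of convergence; at this stage \<open>g\<close> is any entire function.
  If \<open>A\<close> has finitely many zeros, \<open>v\<close> is a polynomial and has growth at most \<open>\<alpha>\<close> for every \<open>\<alpha> > 0\<close>.
\<close>

lemma zeros_convergence_factorization:
  assumes hol: "A holomorphic_on UNIV" and nz: "\<exists>z. A z \<noteq> 0" and \<alpha>: "\<alpha> > 0"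
    and sm: "(\<lambda>z. of_int (zorder A z) * norm z powr (- \<alpha>)) summable_on {z. z \<noteq> 0 \<and> A z = 0}"
  obtains v g where "v holomorphic_on UNIV" "g holomorphic_on UNIV" "\<And>z. A z = v z * exp (g z)"
    "growth_at_most \<alpha> v"
proof (cases "finite {z. A z = 0}")
  case True
  obtain m :: "complex \<Rightarrow> nat" and h where h: "h holomorphic_on UNIV" "\<And>a. a \<in> {z. A z = 0} \<Longrightarrow> h a \<noteq> 0"
     "\<And>z. A z = (\<Prod>a\<in>{z. A z = 0}. (z - a) ^ m a) * h z"
    using entire_divide_out_zeros[OF hol nz True] by metis
  have hnz: "h z \<noteq> 0" for z
    using h(2)[of z] h(3)[of z] by (cases "A z = 0") auto
  obtain g where g: "g holomorphic_on UNIV" "\<And>z. h z = exp (g z)"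
    using holomorphic_log_ex[OF open_UNIV convex_UNIV h(1) hnz] by auto
  show thesis
  proof (rule that[of "\<lambda>z. \<Prod>a\<in>{z. A z = 0}. (z - a) ^ m a" g])
    show "growth_at_most \<alpha> (\<lambda>z. \<Prod>a\<in>{z. A z = 0}. (z - a) ^ m a)"
      by (intro growth_at_most_prod growth_at_most_power growth_at_most_linear \<alpha>)
    show "A z = (\<Prod>a\<in>{z. A z = 0}. (z - a) ^ m a) * exp (g z)" for z
      by (subst h(3)) (simp only: g(2))
  qed (auto intro!: holomorphic_intros g(1))
next
  case False
  define N where "N = {z. z \<noteq> 0 \<and> A z = 0}"
  have finN: "finite (N \<inter> cball 0 r)" for r
  proof (rule finite_subset)
    show "N \<inter> cball 0 r \<subseteq> {z \<in> cball 0 r. A z = 0}" by (auto simp: N_def)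
    show "finite {z \<in> cball 0 r. A z = 0}" by (rule entire_not_constant_zeros_finite[OF hol nz compact_cball])
  qed
  have infN: "infinite N"
  proof
    assume "finite N"
    then have "finite (insert 0 N)" by simp
    then have "finite {z. A z = 0}" by (rule rev_finite_subset) (auto simp: N_def)
    with False show False by simp
  qed
  have closedN: "closed N"
    unfolding closed_limpt
  proof (intro allI impI)
    fix x assume "x islimpt N"
    then have "infinite (N \<inter> ball x 1)"
      by (auto simp: islimpt_eq_infinite_ball)
    moreover have "N \<inter> ball x 1 \<subseteq> N \<inter> cball 0 (norm x + 1)"
    proof
      fix y assume "y \<in> N \<inter> ball x 1"
      then show "y \<in> N \<inter> cball 0 (norm x + 1)"
        using norm_triangle_ineq2[of y x] by (simp add: dist_norm norm_minus_commute)
    qed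
    ultimately show "x \<in> N" using finN finite_subset by blast
  qed
  \<comment> \<open>The zero at the origin has to be split off, since the canonical product needs nonzero \<open>a n\<close>.\<close>
  obtain k :: nat and A1 where A1: "A1 holomorphic_on UNIV" "A1 0 \<noteq> 0" "\<And>z. A z = (z - 0) ^ k * A1 z"
    using entire_divide_out_zero[OF hol nz] by metis
  have A1': "A = (\<lambda>z. z ^ k * A1 z)" using A1(3) by auto
  have A1nz: "A1 z = 0 \<longleftrightarrow> z \<in> N" for z
    using A1 by (cases "z = 0") (auto simp: N_def)
  have an: "A1 analytic_on {z}" for z
    using A1(1) by (simp add: analytic_on_holomorphic) blast
  have evnz: "eventually (\<lambda>w. A1 w \<noteq> 0) (at z)" for z
    using non_zero_neighbour_alt[OF A1(1) open_UNIV connected_UNIV, of z 0] A1(2) by auto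
  have ord: "zorder A z = zorder A1 z" if z: "z \<in> N" for z
  proof -
    have "zorder (\<lambda>w. w ^ k * A1 w) z = zorder (\<lambda>w. w ^ k) z + zorder A1 z"
    proof (rule zorder_times_analytic)
      have "eventually (\<lambda>w. w \<noteq> 0) (at z)"
        using z by (intro eventually_neq_at_within) 
      with evnz[of z] show "eventually (\<lambda>w. w ^ k * A1 w \<noteq> 0) (at z)"
        by eventually_elim auto
    qed (auto intro!: analytic_intros an)
    moreover have "zorder (\<lambda>w::complex. w ^ k) z = 0"
      using z by (intro zorder_eq_0I analytic_intros) (auto simp: N_def)
    ultimately show ?thesis by (simp add: A1')
  qed
  have pos: "zorder A1 z > 0" if z: "z \<in> N" for z
  proof -
    have "frequently (\<lambda>w. A1 w \<noteq> 0) (at z)"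
      using evnz[of z] by (intro eventually_frequently) auto
    then show ?thesis
      using zorder_pos_iff[OF A1(1) open_UNIV, of z] z A1nz by simp
  qed
  have cpos: "nat (zorder A1 z) > 0" if "z \<in> N" for z using pos[OF that] by simp
  obtain a :: "nat \<Rightarrow> complex" where "mono (norm \<circ> a)" and a: "range a = N" "filterlim a at_infinity at_top"
    "\<And>z. z \<in> N \<Longrightarrow> finite (a -` {z}) \<and> card (a -` {z}) = nat (zorder A1 z)"
    by (rule sequence_of_sparse_set_exists'[OF infN closedN finN cpos]) (assumption | rule that)+
  have sma: "summable (\<lambda>n. norm (a n) powr (- \<alpha>))"
  proof (rule summable_over_fibres[where N = N and m = "\<lambda>z. of_int (zorder A z)" and \<phi> = "\<lambda>z. norm z powr (- \<alpha>)"])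
    show "(\<lambda>z. of_int (zorder A z) * norm z powr (- \<alpha>)) summable_on N"
      using sm by (simp add: N_def)
    fix z assume "z \<in> N"
    then show "finite (a -` {z}) \<and> real (card (a -` {z})) \<le> of_int (zorder A z)"
      using a(3)[of z] pos[of z] ord[of z] by simp
  qed (use a in auto)
  have a0: "a n \<noteq> 0" for n using a(1) by (force simp: N_def)
  obtain v where v: "v holomorphic_on UNIV" "\<And>z. v z = 0 \<longleftrightarrow> z \<in> range a"
    "\<And>z. zorder v z = card (a -` {z})" "growth_at_most \<alpha> v"
    by (rule canonical_product_exists[OF a0 a(2) \<alpha> sma]) (assumption | rule that)+
  have "zorder v z = zorder A1 z" for z
  proof (cases "z \<in> N")
    case True
    then show ?thesis using v(3)[of z] a(3)[of z] pos[of z] by simp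
  next
    case False
    then have "a -` {z} = {}" using a(1) by blast
    moreover have "zorder A1 z = 0" using False A1nz by (intro zorder_eq_0I an) auto
    ultimately show ?thesis using v(3)[of z] by simp
  qed
  moreover have "v z = 0 \<longleftrightarrow> A1 z = 0" for z
    using v(2) a(1) A1nz by simp
  ultimately obtain h where h: "h holomorphic_on UNIV" "\<And>z. h z \<noteq> 0" "\<And>z. A1 z = h z * v z"
    using holomorphic_zorder_factorization[OF A1(1) open_UNIV connected_UNIV v(1)] by auto
  obtain g where g: "g holomorphic_on UNIV" "\<And>z. h z = exp (g z)"
    using holomorphic_log_ex[OF open_UNIV convex_UNIV h(1,2)] by auto
  show thesis
  proof (rule that[of "\<lambda>z. (z - 0) ^ k * v z" g])
    show "growth_at_most \<alpha> (\<lambda>z. (z - 0) ^ k * v z)"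
      by (intro growth_at_most_mult growth_at_most_power growth_at_most_linear \<alpha> v)
  qed (use g h(3) v(1) A1(3) in \<open>auto intro!: holomorphic_intros simp: mult_ac\<close>)
qed

section \<open>Order and lower order\<close>

lemma log_log_le_iff:
  assumes r: "r > 1" and \<tau>: "\<tau> \<ge> 0"
  shows "log_plus (log_plus M) / ln r \<le> \<tau> \<longleftrightarrow> M \<le> exp (r powr \<tau>)"
proof -
  have rp: "r powr \<tau> \<ge> 1" using r \<tau> by (intro ge_one_powr_ge_zero) auto
  have "log_plus (log_plus M) / ln r \<le> \<tau> \<longleftrightarrow> ln (max 1 (log_plus M)) \<le> ln (r powr \<tau>)"
    using r by (simp add: log_plus_def divide_le_eq ln_powr)
  also have "\<dots> \<longleftrightarrow> max 1 (log_plus M) \<le> r powr \<tau>"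
    using r by (intro ln_le_cancel_iff) auto
  also have "\<dots> \<longleftrightarrow> log_plus M \<le> r powr \<tau>" using rp by simp
  also have "\<dots> \<longleftrightarrow> ln (max 1 M) \<le> ln (exp (r powr \<tau>))" by (simp add: log_plus_def)
  also have "\<dots> \<longleftrightarrow> max 1 M \<le> exp (r powr \<tau>)" by (intro ln_le_cancel_iff) auto
  also have "\<dots> \<longleftrightarrow> M \<le> exp (r powr \<tau>)" using rp by simp
  finally show ?thesis .
qed

text \<open>
  Translates the quotient in the definitions of order and lower order into a bound on the circle of
  radius \<open>r\<close>. For \<open>\<tau> \<ge> 0\<close> and \<open>r > 1\<close> the truncations in the positive logarithms have no effect.
\<close>

lemma log_log_max_modulus_le_iff:
  assumes hol: "F holomorphic_on UNIV" and r: "r > 1" and \<tau>: "\<tau> \<ge> 0"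
  shows "log_plus (log_plus (max_modulus r F)) / ln r \<le> \<tau> \<longleftrightarrow> (\<forall>z. norm z = r \<longrightarrow> norm (F z) \<le> exp (r powr \<tau>))"
proof -
  have "continuous_on (sphere 0 r) F"
    using hol holomorphic_on_imp_continuous_on holomorphic_on_subset by blast
  then obtain z where z: "norm z = r" "norm (F z) = max_modulus r F" "\<And>w. norm w = r \<Longrightarrow> norm (F w) \<le> norm (F z)"
    using max_modulus_attained[of r F] r by auto
  have "max_modulus r F \<le> exp (r powr \<tau>) \<longleftrightarrow> (\<forall>z. norm z = r \<longrightarrow> norm (F z) \<le> exp (r powr \<tau>))"
    using z by (metis order_trans)
  then show ?thesis unfolding log_log_le_iff[OF r \<tau>] .
qed

lemma growth_order_lessD:
  assumes hol: "F holomorphic_on UNIV" and \<tau>: "\<tau> \<ge> 0" and lt: "growth_order F < ereal \<tau>"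
  shows "\<forall>\<^sub>F r in at_top. \<forall>z. norm z = r \<longrightarrow> norm (F z) \<le> exp (r powr \<tau>)"
proof -
  have "\<forall>\<^sub>F r in at_top. ereal (log_plus (log_plus (max_modulus r F)) / ln r) < ereal \<tau>"
    using lt unfolding growth_order_def by (rule Limsup_lessD)
  then show ?thesis
    using eventually_gt_at_top[of 1]
  proof eventually_elim
    case (elim r)
    then show ?case using log_log_max_modulus_le_iff[OF hol _ \<tau>, of r] by simp
  qed
qed

lemma growth_order_leI:
  assumes hol: "F holomorphic_on UNIV" and \<tau>: "\<tau> \<ge> 0"
    and ev: "\<forall>\<^sub>F r in at_top. \<forall>z. norm z = r \<longrightarrow> norm (F z) \<le> exp (r powr \<tau>)"
  shows "growth_order F \<le> ereal \<tau>"
  unfolding growth_order_def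
proof (rule Limsup_bounded)
  show "\<forall>\<^sub>F r in at_top. ereal (log_plus (log_plus (max_modulus r F)) / ln r) \<le> ereal \<tau>"
    using ev eventually_gt_at_top[of 1]
  proof eventually_elim
    case (elim r)
    then show ?case using log_log_max_modulus_le_iff[OF hol _ \<tau>, of r] by simp
  qed
qed

lemma lower_growth_order_lessD:
  assumes hol: "F holomorphic_on UNIV" and \<tau>: "\<tau> \<ge> 0" and lt: "lower_growth_order F < ereal \<tau>"
  shows "\<exists>r\<ge>X. \<forall>z. norm z = r \<longrightarrow> norm (F z) \<le> exp (r powr \<tau>)"
proof (rule ccontr)
  assume no: "\<not> ?thesis"
  have "\<forall>\<^sub>F r in at_top. ereal \<tau> \<le> ereal (log_plus (log_plus (max_modulus r F)) / ln r)"
    using eventually_gt_at_top[of 1] eventually_ge_at_top[of X]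
  proof eventually_elim
    case (elim r)
    then show ?case using log_log_max_modulus_le_iff[OF hol _ \<tau>, of r] no by fastforce
  qed
  then have "ereal \<tau> \<le> lower_growth_order F"
    unfolding lower_growth_order_def by (rule Liminf_bounded)
  with lt show False by simp
qed

lemma lower_growth_order_leI:
  assumes hol: "F holomorphic_on UNIV" and \<tau>: "\<tau> \<ge> 0"
    and freq: "\<And>X. \<exists>r\<ge>X. \<forall>z. norm z = r \<longrightarrow> norm (F z) \<le> exp (r powr \<tau>)"
  shows "lower_growth_order F \<le> ereal \<tau>"
proof (rule ccontr)
  assume "\<not> ?thesis"
  then have "\<forall>\<^sub>F r in at_top. ereal \<tau> < ereal (log_plus (log_plus (max_modulus r F)) / ln r)"
    unfolding lower_growth_order_def by (intro less_LiminfD) simp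
  then obtain X where X: "\<And>r. r \<ge> X \<Longrightarrow> \<tau> < log_plus (log_plus (max_modulus r F)) / ln r"
    by (auto simp: eventually_at_top_linorder)
  obtain r where r: "r \<ge> max X 2" "\<forall>z. norm z = r \<longrightarrow> norm (F z) \<le> exp (r powr \<tau>)"
    using freq by blast
  then have "log_plus (log_plus (max_modulus r F)) / ln r \<le> \<tau>"
    using log_log_max_modulus_le_iff[OF hol _ \<tau>, of r] by simp
  with X[of r] r(1) show False by simp
qed

lemma finite_growthI:
  assumes hol: "F holomorphic_on UNIV" and fin: "growth_order F \<noteq> \<infinity>"
  shows "finite_growth F"
proof -
  obtain K :: real where "growth_order F < ereal K"
    using fin by (metis ereal_dense2 ereal_infty_less(1))
  also have "ereal K \<le> ereal (real (nat \<lceil>K\<rceil>))" by (simp add: real_nat_ceiling_ge)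
  finally have "growth_order F < ereal (real (nat \<lceil>K\<rceil>))" .
  then have "\<forall>\<^sub>F r in at_top. \<forall>z. norm z = r \<longrightarrow> norm (F z) \<le> exp (r powr (nat \<lceil>K\<rceil>))"
    by (intro growth_order_lessD[OF hol]) auto
  then obtain X where X: "\<And>z. norm z \<ge> X \<Longrightarrow> norm (F z) \<le> exp (norm z powr (nat \<lceil>K\<rceil>))"
    by (auto simp: eventually_at_top_linorder)
  define k where "k = nat \<lceil>K\<rceil>"
  obtain C0 where C0: "\<And>z. norm z \<le> X \<Longrightarrow> norm (F z) \<le> C0"
    using entire_bounded_on_cball[OF hol, of X] by blast
  define C where "C = 1 + \<bar>C0\<bar>"
  have "norm (F z) \<le> exp (C * (1 + norm z) ^ k)" for z
  proof (cases "norm z \<le> X")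
    case True
    have "norm (F z) \<le> C * 1" using C0[OF True] by (simp add: C_def)
    also have "\<dots> \<le> C * (1 + norm z) ^ k"
      by (intro mult_left_mono) (auto simp: C_def one_le_power)
    also have "\<dots> \<le> exp (C * (1 + norm z) ^ k)"
      using exp_ge_add_one_self[of "C * (1 + norm z) ^ k"] by linarith
    finally show ?thesis .
  next
    case False
    then have "norm (F z) \<le> exp (norm z powr real k)" using X[of z] by (simp add: k_def)
    also have "norm z powr real k \<le> (1 + norm z) powr real k" by (intro powr_mono2) auto
    also have "\<dots> = 1 * (1 + norm z) ^ k" by (simp add: powr_realpow add_pos_nonneg)
    also have "\<dots> \<le> C * (1 + norm z) ^ k" by (intro mult_right_mono) (auto simp: C_def)
    finally show ?thesis by simp
  qed
  moreover have "C \<ge> 0" by (simp add: C_def)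
  ultimately show ?thesis unfolding finite_growth_def by blast
qed

lemma eventually_powr_dominated:
  fixes \<beta> \<tau> K d :: real
  assumes "0 \<le> \<beta>" "\<beta> < \<tau>" "d > 0"
  shows "\<forall>\<^sub>F r in at_top. K * (1 + r) powr \<beta> \<le> d * r powr \<tau>"
proof -
  define K' where "K' = max K 0 * 2 powr \<beta> / d"
  have "filterlim (\<lambda>r::real. exp ((\<tau> - \<beta>) * ln r)) at_top at_top"
    using assms by (intro filterlim_compose[OF exp_at_top]
        filterlim_tendsto_pos_mult_at_top[OF tendsto_const] ln_at_top) auto
  then have "\<forall>\<^sub>F r in at_top. K' \<le> exp ((\<tau> - \<beta>) * ln r)" by (simp add: filterlim_at_top)
  then show ?thesis using eventually_ge_at_top[of 1]
  proof eventually_elim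
    case (elim r)
    have K': "K' \<le> r powr (\<tau> - \<beta>)" using elim by (simp add: powr_def)
    have "K * (1 + r) powr \<beta> \<le> max K 0 * (2 * r) powr \<beta>"
      using elim assms by (intro mult_mono powr_mono2) auto
    also have "\<dots> = d * K' * r powr \<beta>" using elim assms by (simp add: K'_def powr_mult)
    also have "\<dots> \<le> d * r powr (\<tau> - \<beta>) * r powr \<beta>"
      using K' assms by (intro mult_right_mono mult_left_mono) auto
    also have "\<dots> = d * r powr \<tau>" using elim by (simp add: powr_add[symmetric])
    finally show ?case .
  qed
qed

lemma growth_at_most_imp_growth_order_le:
  assumes hol: "F holomorphic_on UNIV" and F: "growth_at_most \<beta> F" and \<beta>: "0 \<le> \<beta>"
  shows "growth_order F \<le> ereal \<beta>"
proof (rule ereal_le_epsilon2)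
  fix e :: real assume e: "0 < e"
  obtain C where C: "\<And>z. norm (F z) \<le> exp (C * (1 + norm z) powr \<beta>)"
    using F by (auto simp: growth_at_most_def)
  have "\<forall>\<^sub>F r in at_top. C * (1 + r) powr \<beta> \<le> 1 * r powr (\<beta> + e)"
    using \<beta> e by (intro eventually_powr_dominated) auto
  then have "\<forall>\<^sub>F r in at_top. \<forall>z. norm z = r \<longrightarrow> norm (F z) \<le> exp (r powr (\<beta> + e))"
  proof eventually_elim
    case (elim r)
    then show ?case using C order_trans exp_le_cancel_iff by (metis mult_1)
  qed
  then have "growth_order F \<le> ereal (\<beta> + e)"
    using \<beta> e by (intro growth_order_leI[OF hol]) auto
  then show "growth_order F \<le> ereal \<beta> + ereal e" by simp
qed

lemma growth_at_most_mono:
  assumes "growth_at_most \<alpha> F" "\<alpha> \<le> \<beta>"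
  shows "growth_at_most \<beta> F"
proof -
  obtain C where C: "C \<ge> 0" "\<And>z. norm (F z) \<le> exp (C * (1 + norm z) powr \<alpha>)"
    using assms(1) by (auto simp: growth_at_most_def)
  have "norm (F z) \<le> exp (C * (1 + norm z) powr \<beta>)" for z
    by (rule order_trans[OF C(2)]) (use C(1) assms(2) in \<open>auto intro!: mult_left_mono powr_mono\<close>)
  with C(1) show ?thesis by (auto simp: growth_at_most_def)
qed

lemma finite_growth_iff: "finite_growth F \<longleftrightarrow> (\<exists>k::nat. growth_at_most (real k) F)"
proof -
  have "(1 + norm z) powr real k = (1 + norm z) ^ k" for z :: complex and k
    by (rule powr_realpow) (simp add: add_pos_nonneg)
  then show ?thesis unfolding finite_growth_def growth_at_most_def by auto
qed

lemma growth_at_most_imp_finite_growth: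
  assumes "growth_at_most \<alpha> F"
  shows "finite_growth F"
  unfolding finite_growth_iff
  by (rule exI[of _ "nat \<lceil>\<alpha>\<rceil>"], rule growth_at_most_mono[OF assms]) linarith

lemma finite_growth_mult:
  assumes "finite_growth F" "finite_growth G"
  shows "finite_growth (\<lambda>z. F z * G z)"
proof -
  obtain k l :: nat where "growth_at_most (real k) F" "growth_at_most (real l) G"
    using assms by (auto simp: finite_growth_iff)
  then have "growth_at_most (real (max k l)) (\<lambda>z. F z * G z)"
    by (intro growth_at_most_mult) (auto elim: growth_at_most_mono)
  then show ?thesis by (auto simp: finite_growth_iff)
qed

section \<open>Zero-free quotients of finite lower order\<close>

text \<open>
  The hypothesis bounds the real part of \<open>g\<close> on a sequence of discs about \<open>w\<close>, Borel-Caratheodory bounds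
  \<open>g\<close> on the discs of half the radius, and Cauchy's estimates make the Taylor coefficients beyond the
  degree \<open>k\<close> vanish.
\<close>

lemma entire_exp_growth_imp_poly:
  assumes hol: "g holomorphic_on UNIV"
    and bd: "\<And>X. \<exists>R\<ge>X. \<forall>z\<in>ball w R. norm (exp (g z)) \<le> exp (C * R ^ k)"
  shows "\<exists>p. \<forall>z. g z = poly p z"
proof -
  have zero: "(deriv ^^ n) g w = 0" if n: "n > k" for n
  proof (rule ccontr)
    assume nz: "(deriv ^^ n) g w \<noteq> 0"
    define D where "D = \<bar>C\<bar> + norm (g w) + 1"
    \<comment> \<open>Cauchy's estimate on the disc of radius \<open>R/4\<close> will yield \<open>R \<le> Q\<close>, which fails for large \<open>R\<close>.\<close>
    define Q where "Q = fact n * (2 * D + norm (g w)) * 4 ^ n / norm ((deriv ^^ n) g w)"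
    obtain R where R: "R \<ge> max 1 (Q + 1)" "\<And>z. z \<in> ball w R \<Longrightarrow> norm (exp (g z)) \<le> exp (C * R ^ k)"
      using bd by blast
    have R1: "R \<ge> 1" and Rk: "R ^ k \<ge> 1" using R(1) by (auto simp: one_le_power)
    have half: "norm (g z - g w) \<le> 2 * (D * R ^ k)" if "z \<in> ball w (R/2)" for z
    proof (rule Borel_Caratheodory_half[of "\<lambda>z. g z - g w" w R])
      show "(\<lambda>z. g z - g w) holomorphic_on ball w R"
        using holomorphic_on_subset[OF hol] by (intro holomorphic_intros) auto
      fix z assume "z \<in> ball w R"
      then have "Re (g z) \<le> C * R ^ k" using R(2)[of z] by simp
      also have "\<dots> \<le> \<bar>C\<bar> * R ^ k" using R1 by (intro mult_right_mono) auto
      finally have "Re (g z - g w) \<le> \<bar>C\<bar> * R ^ k + norm (g w)"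
        using abs_Re_le_cmod[of "g w"] by simp
      also have "\<dots> < \<bar>C\<bar> * R ^ k + (norm (g w) + 1) * 1" by simp
      also have "\<dots> \<le> \<bar>C\<bar> * R ^ k + (norm (g w) + 1) * R ^ k"
        using Rk by (intro add_left_mono mult_left_mono) auto
      finally show "Re (g z - g w) < D * R ^ k" by (simp add: D_def algebra_simps)
    qed (use R1 that in auto)
    have "norm ((deriv ^^ n) g w) \<le> fact n * ((2 * D + norm (g w)) * R ^ k) / (R/4) ^ n"
    proof (rule Cauchy_inequality)
      show "g holomorphic_on ball w (R/4)" "continuous_on (cball w (R/4)) g"
        using hol holomorphic_on_subset holomorphic_on_imp_continuous_on by blast+
      show "R / 4 > 0" using R1 by simp
      fix x assume "norm (w - x) = R/4"
      then have "norm (g x - g w) \<le> 2 * (D * R ^ k)" using R1 by (intro half) (simp add: dist_norm)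
      then have "norm (g x) \<le> 2 * (D * R ^ k) + norm (g w) * 1"
        using norm_triangle_ineq2[of "g x" "g w"] by simp
      also have "\<dots> \<le> 2 * (D * R ^ k) + norm (g w) * R ^ k"
        using Rk by (intro add_left_mono mult_left_mono) auto
      finally show "norm (g x) \<le> (2 * D + norm (g w)) * R ^ k" by (simp add: algebra_simps)
    qed
    also have "\<dots> = fact n * (2 * D + norm (g w)) * 4 ^ n * (R ^ k / R ^ n)"
      by (simp add: power_divide)
    also have "\<dots> \<le> fact n * (2 * D + norm (g w)) * 4 ^ n * (1 / R)"
    proof (rule mult_left_mono)
      have "R ^ k * R \<le> R ^ n"
        using power_increasing[of "Suc k" n R] n R1 by (simp add: mult.commute)
      then show "R ^ k / R ^ n \<le> 1 / R" using R1 by (simp add: field_simps)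
    qed (simp add: D_def)
    finally have "norm ((deriv ^^ n) g w) \<le> fact n * (2 * D + norm (g w)) * 4 ^ n * (1 / R)" .
    then have "R \<le> Q" using nz R1 by (simp add: Q_def field_simps)
    with R(1) show False by simp
  qed
  define p where "p = (\<Sum>n\<le>k. smult ((deriv ^^ n) g w / fact n) ([:- w, 1:] ^ n))"
  have "g z = poly p z" for z
  proof -
    have s: "(\<lambda>n. (deriv ^^ n) g w / fact n * (z - w) ^ n) sums g z"
      by (rule holomorphic_power_series[of g w "norm (z - w) + 1"])
        (auto intro: holomorphic_on_subset[OF hol] simp: dist_norm norm_minus_commute)
    have "(\<lambda>n. (deriv ^^ n) g w / fact n * (z - w) ^ n) sums (\<Sum>n\<le>k. (deriv ^^ n) g w / fact n * (z - w) ^ n)"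
      by (rule sums_finite) (use zero in auto)
    with s have "g z = (\<Sum>n\<le>k. (deriv ^^ n) g w / fact n * (z - w) ^ n)" by (rule sums_unique2)
    then show ?thesis by (simp add: p_def poly_sum poly_power)
  qed
  then show ?thesis by blast
qed

text \<open>
  The growth of \<open>F e\<^sup>g\<close> needs to be known on a sequence of discs only, because the quotient estimate
  works on each disc separately.
\<close>

lemma exp_quotient_imp_poly:
  assumes holF: "F holomorphic_on UNIV" and F: "finite_growth F" and Fw: "F w \<noteq> 0"
    and hol: "g holomorphic_on UNIV"
    and bd: "\<And>X. \<exists>r\<ge>X. \<forall>z. norm z \<le> r \<longrightarrow> norm (F z * exp (g z)) \<le> exp (C * (1 + r) ^ k)"
  shows "\<exists>p. \<forall>z. g z = poly p z"
proof -
  obtain D l where D: "D \<ge> 0" "\<And>z. norm (F z) \<le> exp (D * (1 + norm z) ^ l)"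
    using F by (auto simp: finite_growth_def)
  define E where "E = 7 + norm w"
  define b where "b = \<bar>ln (norm (F w))\<bar>"
  define C1 where "C1 = (\<bar>C\<bar> + 2 * D + 2 + 3 * b) * E ^ (k + l)"
  have "\<exists>R\<ge>X. \<forall>z\<in>ball w R. norm (exp (g z)) \<le> exp (C1 * R ^ (k + l))" for X
  proof -
    obtain r where r: "r \<ge> 6 * max 1 X + norm w" "\<And>z. norm z \<le> r \<Longrightarrow> norm (F z * exp (g z)) \<le> exp (C * (1 + r) ^ k)"
      using bd by blast
    define R where "R = (r - norm w) / 6"
    have R: "R \<ge> 1" "R \<ge> X" using r(1) by (auto simp: R_def)
    have r6: "6 * R = r - norm w" by (simp add: R_def)
    have inr: "norm z \<le> r" if "z \<in> cball w (6 * R)" for z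
      using that norm_triangle_ineq2[of z w] by (simp add: r6 dist_norm norm_minus_commute)
    have r0: "r \<ge> 0" using r6 R(1) norm_ge_zero[of w] by linarith
    have rE: "1 + r \<le> E * R"
    proof -
      have "(1 + norm w) * 1 \<le> (1 + norm w) * R" using R(1) by (intro mult_left_mono) auto
      then show ?thesis using r6 by (simp add: E_def algebra_simps)
    qed
    have "norm (exp (g z)) \<le> exp (C1 * R ^ (k + l))" if z: "z \<in> ball w R" for z
    proof -
      have "norm (exp (g z)) \<le> exp (C * (1 + r) ^ k + 2 * (D * (1 + r) ^ l) + 2 - 3 * ln (norm (F w)))"
      proof (rule entire_quotient_bound[OF holF Fw, where R = "6 * R" and H = "\<lambda>z. exp (g z)" and z = z])
        fix y assume y: "y \<in> cball w (6 * R)"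
        have "D * (1 + norm y) ^ l \<le> D * (1 + r) ^ l"
          using D(1) inr[OF y] by (intro mult_left_mono power_mono) auto
        then show "norm (F y) \<le> exp (D * (1 + r) ^ l)"
          using D(2)[of y] by (meson exp_le_cancel_iff order_trans)
        show "norm (F y * exp (g y)) \<le> exp (C * (1 + r) ^ k)" by (rule r(2)[OF inr[OF y]])
      qed (use R z hol in \<open>auto intro!: holomorphic_intros\<close>)
      also have "C * (1 + r) ^ k + 2 * (D * (1 + r) ^ l) + 2 - 3 * ln (norm (F w)) \<le>
          \<bar>C\<bar> * (1 + r) ^ (k + l) + 2 * (D * (1 + r) ^ (k + l)) + (2 + 3 * b) * (1 + r) ^ (k + l)"
      proof -
        have "C * (1 + r) ^ k \<le> \<bar>C\<bar> * (1 + r) ^ (k + l)"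
          using r0 by (intro mult_mono power_increasing) auto
        moreover have "D * (1 + r) ^ l \<le> D * (1 + r) ^ (k + l)"
          using r0 D(1) by (intro mult_left_mono power_increasing) auto
        moreover have "2 - 3 * ln (norm (F w)) \<le> (2 + 3 * b) * (1 + r) ^ (k + l)"
        proof -
          have "2 - 3 * ln (norm (F w)) \<le> (2 + 3 * b) * 1" by (simp add: b_def)
          also have "\<dots> \<le> (2 + 3 * b) * (1 + r) ^ (k + l)"
            using r0 by (intro mult_left_mono) (auto simp: b_def one_le_power)
          finally show ?thesis .
        qed
        moreover have "x + 2 * y + 2 - 3 * t \<le> x' + 2 * y' + u"
          if "x \<le> x'" "y \<le> y'" "2 - 3 * t \<le> u" for x x' y y' t u :: real
          using that by linarith
        ultimately show ?thesis by blast
      qed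
      also have "\<dots> = (\<bar>C\<bar> + 2 * D + 2 + 3 * b) * (1 + r) ^ (k + l)" by (simp add: algebra_simps)
      also have "\<dots> \<le> (\<bar>C\<bar> + 2 * D + 2 + 3 * b) * (E * R) ^ (k + l)"
        using rE r0 D(1) by (intro mult_left_mono power_mono) (auto simp: b_def)
      also have "\<dots> = C1 * R ^ (k + l)" by (simp add: C1_def power_mult_distrib)
      finally show ?thesis by simp
    qed
    with R(2) show ?thesis by blast
  qed
  then show ?thesis by (rule entire_exp_growth_imp_poly[OF hol])
qed

section \<open>The exponential of a polynomial along rays\<close>

lemma norm_poly_lower_terms_le:
  fixes p :: "complex poly"
  shows "norm (poly p z - lead_coeff p * z ^ degree p) \<le> (\<Sum>i<degree p. norm (coeff p i)) * (1 + norm z) ^ (degree p - 1)"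
proof -
  have "poly p z = (\<Sum>i<degree p. coeff p i * z ^ i) + lead_coeff p * z ^ degree p"
    unfolding poly_altdef by (simp flip: lessThan_Suc_atMost)
  then have "norm (poly p z - lead_coeff p * z ^ degree p) = norm (\<Sum>i<degree p. coeff p i * z ^ i)" by simp
  also have "\<dots> \<le> (\<Sum>i<degree p. norm (coeff p i) * (1 + norm z) ^ (degree p - 1))"
  proof (rule sum_norm_le)
    fix i assume "i \<in> {..<degree p}"
    then have "(1 + norm z) ^ i \<le> (1 + norm z) ^ (degree p - 1)"
      by (intro power_increasing) auto
    moreover have "norm z ^ i \<le> (1 + norm z) ^ i" by (intro power_mono) auto
    ultimately show "norm (coeff p i * z ^ i) \<le> norm (coeff p i) * (1 + norm z) ^ (degree p - 1)"
      unfolding norm_mult norm_power by (intro mult_left_mono) auto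
  qed
  finally show ?thesis by (simp add: sum_distrib_right)
qed

lemma growth_at_most_exp_poly: "growth_at_most (real (degree p)) (\<lambda>z. exp (poly p z))"
proof -
  define K where "K = (\<Sum>i\<le>degree p. norm (coeff p i))"
  have "norm (exp (poly p z)) \<le> exp (K * (1 + norm z) powr real (degree p))" for z
  proof -
    have "norm (exp (poly p z)) \<le> exp (norm (poly p z))" by (rule norm_exp)
    also have "norm (poly p z) \<le> (\<Sum>i\<le>degree p. norm (coeff p i) * (1 + norm z) ^ degree p)"
      unfolding poly_altdef
    proof (rule sum_norm_le)
      fix i assume "i \<in> {..degree p}"
      then have "(1 + norm z) ^ i \<le> (1 + norm z) ^ degree p"
        by (intro power_increasing) auto
      moreover have "norm z ^ i \<le> (1 + norm z) ^ i" by (intro power_mono) auto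
      ultimately show "norm (coeff p i * z ^ i) \<le> norm (coeff p i) * (1 + norm z) ^ degree p"
        unfolding norm_mult norm_power by (intro mult_left_mono) auto
    qed
    also have "\<dots> = K * (1 + norm z) powr real (degree p)"
      by (simp add: K_def sum_distrib_right powr_realpow add_pos_nonneg)
    finally show ?thesis by simp
  qed
  moreover have "K \<ge> 0" unfolding K_def by (intro sum_nonneg) auto
  ultimately show ?thesis unfolding growth_at_most_def by blast
qed

text \<open>
  On such a ray the leading term of \<open>p\<close> contributes \<open>- d r\<^sup>n\<close> with \<open>d > 0\<close> to the real part of the exponent,
  and this outweighs both the lower terms of \<open>p\<close> and the growth of \<open>v\<close>.
\<close>

lemma exp_poly_decay_on_ray:
  fixes p :: "complex poly"
  assumes v: "growth_at_most \<alpha> v" and \<alpha>: "0 \<le> \<alpha>" "\<alpha> < real (degree p)"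
    and neg: "cos (Arg (lead_coeff p) + real (degree p) * \<theta>) < 0"
  shows "\<forall>\<^sub>F r in at_top. norm (v (of_real r * cis \<theta>) * exp (poly p (of_real r * cis \<theta>))) \<le> 1"
proof -
  define n where "n = degree p"
  have n: "n \<ge> 1" using \<alpha> by (simp add: n_def)
  define c where "c = lead_coeff p"
  have c0: "c \<noteq> 0" using n by (auto simp: c_def n_def)
  define K where "K = (\<Sum>i<n. norm (coeff p i))"
  have K0: "K \<ge> 0" unfolding K_def by (intro sum_nonneg) auto
  obtain C where C: "C \<ge> 0" "\<And>z. norm (v z) \<le> exp (C * (1 + norm z) powr \<alpha>)"
    using v by (auto simp: growth_at_most_def)
  define d where "d = norm c * (- cos (Arg c + real n * \<theta>))"
  have d: "d > 0"
    unfolding d_def using neg c0 by (intro mult_pos_pos) (auto simp: c_def n_def)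
  define \<beta> where "\<beta> = max \<alpha> (real (n - 1))"
  have \<beta>: "0 \<le> \<beta>" "\<beta> < real n" using \<alpha> n by (auto simp: \<beta>_def n_def)
  have "\<forall>\<^sub>F r in at_top. (C + K) * (1 + r) powr \<beta> \<le> d * r powr real n"
    by (rule eventually_powr_dominated) (use \<beta> d in auto)
  then show ?thesis using eventually_ge_at_top[of 1]
  proof eventually_elim
    case (elim r)
    define z where "z = of_real r * cis \<theta>"
    have nz: "norm z = r" using elim by (simp add: z_def norm_mult)
    have "c * z ^ n = of_real (norm c * r ^ n) * cis (Arg c + real n * \<theta>)"
    proof -
      have "c = of_real (norm c) * cis (Arg c)" by (metis rcis_cmod_Arg rcis_def)
      then have "c * z ^ n = of_real (norm c) * cis (Arg c) * (of_real (r ^ n) * cis (real n * \<theta>))"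
        unfolding z_def power_mult_distrib Complex.DeMoivre of_real_power by simp
      then show ?thesis by (simp add: cis_mult[symmetric])
    qed
    then have "Re (c * z ^ n) = - d * r ^ n" by (simp add: d_def)
    moreover have "Re (poly p z - c * z ^ n) \<le> K * (1 + r) ^ (n - 1)"
      using norm_poly_lower_terms_le[of p z] complex_Re_le_cmod[of "poly p z - c * z ^ n"]
      by (simp add: nz K_def n_def c_def)
    moreover have "(1 + r) ^ (n - 1) = (1 + r) powr real (n - 1)" using elim by (subst powr_realpow) auto
    moreover have "K * (1 + r) powr real (n - 1) \<le> K * (1 + r) powr \<beta>"
      using K0 elim by (intro mult_left_mono powr_mono) (auto simp: \<beta>_def)
    moreover have "C * (1 + r) powr \<alpha> \<le> C * (1 + r) powr \<beta>"
      using C(1) elim by (intro mult_left_mono powr_mono) (auto simp: \<beta>_def)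
    moreover have "r powr real n = r ^ n" using elim by (simp add: powr_realpow)
    ultimately have "C * (1 + r) powr \<alpha> + Re (poly p z) \<le> 0"
      using elim by (simp add: algebra_simps)
    have "norm (v z * exp (poly p z)) \<le> exp (C * (1 + r) powr \<alpha>) * exp (Re (poly p z))"
      unfolding norm_mult norm_exp_eq_Re using C(2)[of z] nz by (intro mult_right_mono) auto
    also have "\<dots> = exp (C * (1 + r) powr \<alpha> + Re (poly p z))" by (simp add: exp_add)
    also have "\<dots> \<le> 1" using \<open>C * (1 + r) powr \<alpha> + Re (poly p z) \<le> 0\<close> by simp
    finally show ?case by (simp add: z_def)
  qed
qed

text \<open>
  The interval from \<open>l\<close> to \<open>u\<close> is the set around \<open>0\<close> on which \<open>cos (\<psi> + x) \<ge> 0\<close>, or the point \<open>0\<close> if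
  \<open>cos \<psi> < 0\<close>; the cosine is negative next to it on both sides.
\<close>

lemma cos_negative_around_gap:
  fixes \<psi> :: real
  obtains l u \<eta> where "l \<le> 0" "0 \<le> u" "u - l \<le> pi" "\<eta> > 0"
    "\<And>x. l - \<eta> < x \<Longrightarrow> x < l \<Longrightarrow> cos (\<psi> + x) < 0"
    "\<And>x. u < x \<Longrightarrow> x < u + \<eta> \<Longrightarrow> cos (\<psi> + x) < 0"
proof (cases "cos \<psi> < 0")
  case True
  have "isCont (\<lambda>x. cos (\<psi> + x)) 0" by (intro continuous_intros)
  then have "\<forall>\<^sub>F x in at 0. cos (\<psi> + x) < 0"
    using True by (auto simp: isCont_def intro: order_tendstoD)
  then obtain \<eta> where \<eta>: "\<eta> > 0" "\<And>x. x \<noteq> 0 \<Longrightarrow> dist x 0 < \<eta> \<Longrightarrow> cos (\<psi> + x) < 0"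
    by (auto simp: eventually_at)
  show thesis
    by (rule that[of 0 0 \<eta>]) (use \<eta> in auto)
next
  case False
  define t where "t = Arg (cis \<psi>)"
  have cis: "cis t = cis \<psi>" unfolding t_def by (simp add: cis_Arg sgn_eq)
  have cs: "cos t = cos \<psi>" "sin t = sin \<psi>" using arg_cong[OF cis, of Re] arg_cong[OF cis, of Im] by auto
  then have shift: "cos (\<psi> + x) = cos (t + x)" for x by (simp add: cos_add)
  have tb: "- pi < t" "t \<le> pi" unfolding t_def using Arg_bounded[of "cis \<psi>"] by auto
  have t2: "\<bar>t\<bar> \<le> pi / 2"
  proof (rule ccontr)
    assume "\<not> \<bar>t\<bar> \<le> pi / 2"
    then have "cos \<bar>t\<bar> < cos (pi/2)" using tb by (intro cos_monotone_0_pi) auto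
    then show False using False cs by simp
  qed
  have neg: "cos y < 0" if "pi/2 < \<bar>y\<bar>" "\<bar>y\<bar> < pi" for y :: real
  proof -
    have "cos \<bar>y\<bar> < cos (pi/2)" using that by (intro cos_monotone_0_pi) auto
    then show ?thesis by simp
  qed
  show thesis
  proof (rule that[of "- pi/2 - t" "pi/2 - t" "pi/2"])
    show "- pi/2 - t \<le> 0" "0 \<le> pi/2 - t" "pi/2 - t - (- pi/2 - t) \<le> pi" "pi/2 > 0"
      using t2 by (auto simp: abs_le_iff)
    show "cos (\<psi> + x) < 0" if "- pi/2 - t - pi/2 < x" "x < - pi/2 - t" for x
      unfolding shift by (rule neg) (use that pi_gt_zero in \<open>auto simp: abs_if\<close>)
    show "cos (\<psi> + x) < 0" if "pi/2 - t < x" "x < pi/2 - t + pi/2" for x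
      unfolding shift by (rule neg) (use that pi_gt_zero in \<open>auto simp: abs_if\<close>)
  qed
qed

section \<open>The differential equation\<close>

text \<open>
  The equation at one point, solved for its last coefficient; the numbers \<open>d0\<close>, \<open>d1\<close>, \<open>d2\<close> stand for the
  values of \<open>f\<close>, \<open>f'\<close> and \<open>f''\<close>.
\<close>

lemma linear_ode_coefficient_bound:
  fixes a b d0 d1 d2 :: complex
  assumes ode: "d2 + a * d1 + b * d0 = 0" and d0: "d0 \<noteq> 0"
    and d1: "norm d1 \<le> K * norm d0" and d2: "norm d2 \<le> K * norm d0"
  shows "norm b \<le> K * (1 + norm a)"
proof -
  have "b * d0 = - (d2 + a * d1)" using ode by (metis add.commute eq_neg_iff_add_eq_0)
  then have "norm b * norm d0 = norm (d2 + a * d1)" by (metis norm_minus_cancel norm_mult)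
  also have "\<dots> \<le> norm d2 + norm a * norm d1" using norm_triangle_ineq[of d2 "a * d1"] by (simp add: norm_mult)
  also have "\<dots> \<le> K * norm d0 + norm a * (K * norm d0)"
    by (intro add_mono d2 mult_left_mono d1) auto
  also have "\<dots> = (K * (1 + norm a)) * norm d0" by (simp add: algebra_simps)
  finally show ?thesis using d0 by simp
qed

text \<open>
  A power of \<open>r\<close> is absorbed by any increase of the exponent \<open>\<tau> > \<rho>(A)\<close>, and arbitrarily large circles
  are enough to bound a lower order.
\<close>

lemma lower_growth_order_le_growth_order:
  assumes holA: "A holomorphic_on UNIV" and holB: "B holomorphic_on UNIV" and A0: "growth_order A > 0"
    and circ: "\<And>X. \<exists>r\<ge>X. \<forall>z. norm z = r \<longrightarrow> norm (B z) \<le> norm z ^ c * (1 + norm (A z))"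
  shows "lower_growth_order B \<le> growth_order A"
proof (rule ccontr)
  assume "\<not> ?thesis"
  then have "growth_order A < lower_growth_order B" by simp
  then obtain \<tau> where \<tau>: "growth_order A < ereal \<tau>" "ereal \<tau> < lower_growth_order B"
    using ereal_dense2 by blast
  obtain \<tau>' where \<tau>': "ereal \<tau> < ereal \<tau>'" "ereal \<tau>' < lower_growth_order B"
    using ereal_dense2[OF \<tau>(2)] by blast
  have t0: "\<tau> > 0" using less_trans[OF A0 \<tau>(1)] by simp
  have tt: "\<tau> < \<tau>'" using \<tau>'(1) by simp
  have "\<forall>\<^sub>F r in at_top. \<forall>z. norm z = r \<longrightarrow> norm (A z) \<le> exp (r powr \<tau>)"
    using t0 by (intro growth_order_lessD[OF holA _ \<tau>(1)]) auto
  moreover have "\<forall>\<^sub>F r in at_top. (real c / \<tau> + 2) * (1 + r) powr \<tau> \<le> 1 * r powr \<tau>'"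
    using t0 tt by (intro eventually_powr_dominated) auto
  ultimately have "\<forall>\<^sub>F r in at_top. (\<forall>z. norm z = r \<longrightarrow> norm (A z) \<le> exp (r powr \<tau>)) \<and>
      (real c / \<tau> + 2) * (1 + r) powr \<tau> \<le> r powr \<tau>'"
    by eventually_elim auto
  then obtain X0 where X0: "\<And>r z. r \<ge> X0 \<Longrightarrow> norm z = r \<Longrightarrow> norm (A z) \<le> exp (r powr \<tau>)"
      "\<And>r. r \<ge> X0 \<Longrightarrow> (real c / \<tau> + 2) * (1 + r) powr \<tau> \<le> r powr \<tau>'"
    unfolding eventually_at_top_linorder by blast
  have "\<exists>r\<ge>X. \<forall>z. norm z = r \<longrightarrow> norm (B z) \<le> exp (r powr \<tau>')" for X
  proof -
    obtain r where r: "r \<ge> max 1 (max X X0)" "\<And>z. norm z = r \<Longrightarrow> norm (B z) \<le> norm z ^ c * (1 + norm (A z))"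
      using circ by blast
    have r1: "r \<ge> 1" using r(1) by simp
    have p1: "r powr \<tau> \<ge> 1" using r1 t0 by (intro ge_one_powr_ge_zero) auto
    have "norm (B z) \<le> exp (r powr \<tau>')" if z: "norm z = r" for z
    proof -
      have "norm (B z) \<le> r ^ c * (1 + norm (A z))" using r(2)[OF z] z by simp
      also have "\<dots> \<le> r ^ c * (1 + exp (r powr \<tau>))"
        using X0(1)[of r z] r z r1 by (intro mult_left_mono) auto
      also have "\<dots> \<le> exp (real c / \<tau> * r powr \<tau>) * exp (2 * r powr \<tau>)"
      proof (rule mult_mono)
        have "r ^ c = exp (real c * ln r)" using r1 by (simp add: exp_of_nat_mult)
        also have "real c * ln r \<le> real c * (r powr \<tau> / \<tau>)"
          using r1 t0 by (intro mult_left_mono ln_powr_bound) auto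
        finally show "r ^ c \<le> exp (real c / \<tau> * r powr \<tau>)" by simp
        have e: "exp (r powr \<tau>) \<ge> 2" using exp_ge_add_one_self[of "r powr \<tau>"] p1 by linarith
        have "1 + exp (r powr \<tau>) \<le> 2 * exp (r powr \<tau>)" using e by simp
        also have "\<dots> \<le> exp (r powr \<tau>) * exp (r powr \<tau>)" using e by (intro mult_right_mono) auto
        also have "\<dots> = exp (2 * r powr \<tau>)" by (simp add: exp_add[symmetric])
        finally show "1 + exp (r powr \<tau>) \<le> exp (2 * r powr \<tau>)" .
      qed (auto intro: add_nonneg_nonneg)
      also have "\<dots> = exp ((real c / \<tau> + 2) * r powr \<tau>)" by (simp add: exp_add[symmetric] algebra_simps)
      also have "(real c / \<tau> + 2) * r powr \<tau> \<le> (real c / \<tau> + 2) * (1 + r) powr \<tau>"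
        using r1 t0 by (intro mult_left_mono powr_mono2) auto
      also have "\<dots> \<le> r powr \<tau>'" using X0(2)[of r] r(1) by simp
      finally show ?thesis by simp
    qed
    then show ?thesis using r(1) by (intro exI[of _ r]) auto
  qed
  then have "lower_growth_order B \<le> ereal \<tau>'"
    using t0 tt by (intro lower_growth_order_leI[OF holB]) auto
  with \<tau>'(2) show False by simp
qed

lemma zeros_convergence_exponentD:
  assumes "zeros_convergence_exponent A < x"
  obtains \<alpha> where "\<alpha> > 0" "ereal \<alpha> < x"
    "(\<lambda>z. of_int (zorder A z) * norm z powr (- \<alpha>)) summable_on {z. z \<noteq> 0 \<and> A z = 0}"
  using assms that unfolding zeros_convergence_exponent_def Inf_less_iff by blast

text \<open>
  The set on which \<open>cos (\<phi> + n t) \<ge> 0\<close> consists of intervals of length \<open>\<pi>/n\<close>. Hence every direction \<open>\<theta>\<close> lies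
  between two good rays that enclose an angle of at most \<open>(\<pi> + 2 \<eta>')/n\<close>, with \<open>\<eta>'\<close> as small as desired.
  Since \<open>\<sigma> < n\<close>, there is room for an exponent \<open>s\<close> between them with \<open>s (\<theta>2 - \<theta>1) < \<pi>\<close>, as the estimate
  for sectors requires.
\<close>

lemma entire_bounded_on_good_rays_imp_poly:
  fixes B :: "complex \<Rightarrow> complex"
  assumes hol: "B holomorphic_on UNIV"
    and n: "\<sigma> \<ge> 0" "\<sigma> < real n"
    and far: "\<And>X. \<exists>r\<ge>X. \<forall>z. norm z = r \<longrightarrow> norm (B z) \<le> exp (r powr \<sigma>)"
    and good: "\<And>u v. u < v \<Longrightarrow> (\<And>t. u < t \<Longrightarrow> t < v \<Longrightarrow> cos (\<phi> + real n * t) < 0) \<Longrightarrow>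
        \<exists>\<theta> C. u < \<theta> \<and> \<theta> < v \<and> (\<forall>r\<ge>1. norm (B (of_real r * cis \<theta>)) \<le> C * r ^ k)"
  shows "\<exists>p. \<forall>z. B z = poly p z"
proof (rule locally_power_bound_imp_poly[OF hol])
  fix \<theta> :: real
  \<comment> \<open>Any \<open>s\<close> strictly between \<open>\<sigma>\<close> and \<open>n\<close> would do.\<close>
  define s where "s = (\<sigma> + real n) / 2"
  have s: "s > 0" "\<sigma> < s" "s < real n" using n by (auto simp: s_def)
  have n0: "real n > 0" using n by linarith
  obtain l u \<eta> where lu: "l \<le> 0" "0 \<le> u" "u - l \<le> pi" "\<eta> > 0"
    "\<And>x. l - \<eta> < x \<Longrightarrow> x < l \<Longrightarrow> cos (\<phi> + real n * \<theta> + x) < 0"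
    "\<And>x. u < x \<Longrightarrow> x < u + \<eta> \<Longrightarrow> cos (\<phi> + real n * \<theta> + x) < 0"
    using cos_negative_around_gap[of "\<phi> + real n * \<theta>"] by metis
  define G where "G = pi * real n / s"
  \<comment> \<open>So small that \<open>\<pi> + 2 \<eta>' < \<pi> n / s\<close>, which makes the final sector narrow enough.\<close>
  define \<eta>' where "\<eta>' = min \<eta> ((G - pi) / 4)"
  have "G > pi" using s by (simp add: G_def less_divide_eq)
  then have \<eta>': "\<eta>' > 0" "\<eta>' \<le> \<eta>" "pi + 2 * \<eta>' < G"
    using lu(4) unfolding \<eta>'_def min_def by (auto simp: field_simps)
  have sub: "\<phi> + real n * t = \<phi> + real n * \<theta> + real n * (t - \<theta>)" for t by (simp add: algebra_simps)
  have "\<exists>\<theta>1 C. \<theta> + (l - \<eta>') / n < \<theta>1 \<and> \<theta>1 < \<theta> + l / n \<and> (\<forall>r\<ge>1. norm (B (of_real r * cis \<theta>1)) \<le> C * r ^ k)"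
  proof (rule good)
    show "\<theta> + (l - \<eta>') / n < \<theta> + l / n" using \<eta>' n0 by (simp add: divide_strict_right_mono)
    fix t assume "\<theta> + (l - \<eta>') / n < t" "t < \<theta> + l / n"
    then have "l - \<eta>' < real n * (t - \<theta>)" "real n * (t - \<theta>) < l"
      using n0 by (simp_all add: field_simps)
    then show "cos (\<phi> + real n * t) < 0"
      unfolding sub[of t] using \<eta>'(2) by (intro lu(5)) auto
  qed
  then obtain \<theta>1 C1 where 1: "\<theta> + (l - \<eta>') / n < \<theta>1" "\<theta>1 < \<theta> + l / n"
      "\<And>r. r \<ge> 1 \<Longrightarrow> norm (B (of_real r * cis \<theta>1)) \<le> C1 * r ^ k" by blast
  have "\<exists>\<theta>2 C. \<theta> + u / n < \<theta>2 \<and> \<theta>2 < \<theta> + (u + \<eta>') / n \<and> (\<forall>r\<ge>1. norm (B (of_real r * cis \<theta>2)) \<le> C * r ^ k)"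
  proof (rule good)
    show "\<theta> + u / n < \<theta> + (u + \<eta>') / n" using \<eta>' n0 by (simp add: divide_strict_right_mono)
    fix t assume "\<theta> + u / n < t" "t < \<theta> + (u + \<eta>') / n"
    then have "u < real n * (t - \<theta>)" "real n * (t - \<theta>) < u + \<eta>'"
      using n0 by (simp_all add: field_simps)
    then show "cos (\<phi> + real n * t) < 0"
      unfolding sub[of t] using \<eta>'(2) by (intro lu(6)) auto
  qed
  then obtain \<theta>2 C2 where 2: "\<theta> + u / n < \<theta>2" "\<theta>2 < \<theta> + (u + \<eta>') / n"
      "\<And>r. r \<ge> 1 \<Longrightarrow> norm (B (of_real r * cis \<theta>2)) \<le> C2 * r ^ k" by blast
  have t1: "\<theta>1 < \<theta>" using 1(2) divide_nonpos_pos[OF lu(1) n0] by linarith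
  have t2: "\<theta> < \<theta>2" using 2(1) divide_nonneg_pos[OF lu(2) n0] by linarith
  have "\<theta>2 - \<theta>1 < (u + \<eta>') / n - (l - \<eta>') / n" using 1(1) 2(2) by linarith
  also have "\<dots> = (u - l + 2 * \<eta>') / n"
    unfolding diff_divide_distrib[symmetric] by (simp add: algebra_simps)
  also have "\<dots> \<le> (pi + 2 * \<eta>') / n" using lu(3) n0 by (intro divide_right_mono) auto
  also have "\<dots> < G / n" using \<eta>'(3) n0 by (intro divide_strict_right_mono) auto
  also have "\<dots> = pi / s" using n0 by (simp add: G_def)
  finally have gap: "s * (\<theta>2 - \<theta>1) < pi" using s(1) by (simp add: field_simps)
  define C where "C = max C1 C2"
  have le: "C1 * r ^ k \<le> C * r ^ k" "C2 * r ^ k \<le> C * r ^ k" if "r \<ge> 1" for r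
    using that by (auto simp: C_def intro!: mult_right_mono)
  obtain C' where "\<And>r t. r \<ge> 1 \<Longrightarrow> t \<in> {\<theta>1..\<theta>2} \<Longrightarrow> norm (B (of_real r * cis t)) \<le> C' * r ^ k"
  proof (rule power_bound_on_sector[OF hol _ s(1) gap s(2)])
    show "\<theta>1 < \<theta>2" using t1 t2 by simp
    show "norm (B (of_real r * cis \<theta>1)) \<le> C * r ^ k" if "r \<ge> 1" for r
      using 1(3)[OF that] le(1)[OF that] by linarith
    show "norm (B (of_real r * cis \<theta>2)) \<le> C * r ^ k" if "r \<ge> 1" for r
      using 2(3)[OF that] le(2)[OF that] by linarith
  qed (use far in blast)+
  then show "\<exists>\<theta>1 \<theta>2 C. \<theta>1 < \<theta> \<and> \<theta> < \<theta>2 \<and> (\<forall>r\<ge>1. \<forall>t\<in>{\<theta>1..\<theta>2}. norm (B (of_real r * cis t)) \<le> C * r ^ k)"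
    using t1 t2 by blast
qed

text \<open>
  The equation exhibits \<open>e\<^sup>g\<close> as the quotient of \<open>- (f'' + B f)\<close> by \<open>v f'\<close>. The factor \<open>B\<close> is under control
  on a sequence of circles only, and thus by the maximum principle on the discs that they bound.
\<close>

lemma coefficient_exponent_is_poly:
  assumes holf: "f holomorphic_on UNIV" and holB: "B holomorphic_on UNIV"
    and ode: "\<And>z. deriv (deriv f) z + v z * exp (g z) * deriv f z + B z * f z = 0"
    and fg: "finite_growth f"
    and v: "v holomorphic_on UNIV" "finite_growth v" and g: "g holomorphic_on UNIV"
    and w: "v w \<noteq> 0" "deriv f w \<noteq> 0"
    and far: "\<And>X. \<exists>r\<ge>X. \<forall>z. norm z = r \<longrightarrow> norm (B z) \<le> exp (r powr \<sigma>)"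
  shows "\<exists>p. \<forall>z. g z = poly p z"
proof -
  have holf': "deriv f holomorphic_on UNIV" by (intro holomorphic_deriv holf) auto
  have fg': "finite_growth (deriv f)" by (rule finite_growth_deriv[OF holf fg])
  have fg'': "finite_growth (deriv (deriv f))" by (rule finite_growth_deriv[OF holf' fg'])
  obtain C0 k0 where 0: "C0 \<ge> 0" "\<And>z. norm (f z) \<le> exp (C0 * (1 + norm z) ^ k0)"
    using fg by (auto simp: finite_growth_def)
  obtain C2 k2 where 2: "C2 \<ge> 0" "\<And>z. norm (deriv (deriv f) z) \<le> exp (C2 * (1 + norm z) ^ k2)"
    using fg'' by (auto simp: finite_growth_def)
  define k where "k = k0 + k2 + nat \<lceil>\<sigma>\<rceil>"
  define C where "C = C0 + C2 + 2"
  show ?thesis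
  proof (rule exp_quotient_imp_poly[of "\<lambda>z. v z * deriv f z" w g C k])
    show "(\<lambda>z. v z * deriv f z) holomorphic_on UNIV" by (intro holomorphic_intros v holf')
    show "finite_growth (\<lambda>z. v z * deriv f z)" by (rule finite_growth_mult[OF v(2) fg'])
    show "v w * deriv f w \<noteq> 0" using w by simp
    show "g holomorphic_on UNIV" by (rule g)
    fix X :: real
    obtain r where r: "r \<ge> max X 1" "\<And>z. norm z = r \<Longrightarrow> norm (B z) \<le> exp (r powr \<sigma>)"
      using far by blast
    have r1: "r \<ge> 1" using r(1) by simp
    define T where "T = (1 + r) ^ k"
    have T1: "T \<ge> 1" using r1 by (simp add: T_def one_le_power)
    have rT: "r powr \<sigma> \<le> T"
    proof -
      have "r powr \<sigma> \<le> r powr real (nat \<lceil>\<sigma>\<rceil>)"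
        using r1 by (intro powr_mono real_nat_ceiling_ge)
      also have "\<dots> = r ^ nat \<lceil>\<sigma>\<rceil>" using r1 by (subst powr_realpow) auto
      also have "\<dots> \<le> (1 + r) ^ nat \<lceil>\<sigma>\<rceil>" using r1 by (intro power_mono) auto
      also have "\<dots> \<le> T" unfolding T_def using r1 by (intro power_increasing) (auto simp: k_def)
      finally show ?thesis .
    qed
    have "norm (v z * deriv f z * exp (g z)) \<le> exp (C * T)" if z: "norm z \<le> r" for z
    proof -
      have "v z * deriv f z * exp (g z) = - (deriv (deriv f) z + B z * f z)"
        using ode[of z] by (simp add: eq_neg_iff_add_eq_0 algebra_simps)
      then have "norm (v z * deriv f z * exp (g z)) \<le> norm (deriv (deriv f) z) + norm (B z) * norm (f z)"
        by (metis norm_minus_cancel norm_mult norm_triangle_ineq)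
      also have "\<dots> \<le> exp (C2 * T) + exp T * exp (C0 * T)"
      proof (intro add_mono mult_mono)
        have pw: "(1 + norm z) ^ j \<le> T" if "j \<le> k" for j
        proof -
          have "(1 + norm z) ^ j \<le> (1 + r) ^ j" using z by (intro power_mono) auto
          also have "\<dots> \<le> T" unfolding T_def using that r1 by (intro power_increasing) auto
          finally show ?thesis .
        qed
        have "C2 * (1 + norm z) ^ k2 \<le> C2 * T" using 2(1) by (intro mult_left_mono pw) (auto simp: k_def)
        with 2(2)[of z] show "norm (deriv (deriv f) z) \<le> exp (C2 * T)"
          by (meson exp_le_cancel_iff order_trans)
        have "C0 * (1 + norm z) ^ k0 \<le> C0 * T" using 0(1) by (intro mult_left_mono pw) (auto simp: k_def)
        with 0(2)[of z] show "norm (f z) \<le> exp (C0 * T)"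
          by (meson exp_le_cancel_iff order_trans)
        have "norm (B z) \<le> exp (r powr \<sigma>)" by (rule entire_maximum_modulus_cball[OF holB, of 0 r]) (use r(2) z in auto)
        with rT show "norm (B z) \<le> exp T" by (meson exp_le_cancel_iff order_trans)
      qed auto
      also have "\<dots> \<le> exp ((C0 + C2 + 1) * T) + exp ((C0 + C2 + 1) * T)"
        unfolding exp_add[symmetric] using 0(1) 2(1) T1
        by (intro add_mono) (auto simp: algebra_simps)
      also have "\<dots> = 2 * exp ((C0 + C2 + 1) * T)" by simp
      also have "\<dots> \<le> exp T * exp ((C0 + C2 + 1) * T)"
      proof (rule mult_right_mono)
        show "2 \<le> exp T" using exp_ge_add_one_self[of T] T1 by linarith
      qed simp
      also have "\<dots> = exp (C * T)" by (simp add: C_def exp_add[symmetric] algebra_simps)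
      finally show ?thesis .
    qed
    then show "\<exists>r\<ge>X. \<forall>z. norm z \<le> r \<longrightarrow> norm (v z * deriv f z * exp (g z)) \<le> exp (C * (1 + r) ^ k)"
      using r(1) by (intro exI[of _ r]) (auto simp: T_def)
  qed
qed

theorem theorem8:
  fixes A B f :: "complex \<Rightarrow> complex"
  assumes "transcendental_entire A" and "transcendental_entire B"
    and "zeros_convergence_exponent A < growth_order A"
    and "lower_growth_order B \<noteq> growth_order A"
    and "f holomorphic_on UNIV"
    and "\<And>z. deriv (deriv f) z + A z * deriv f z + B z * f z = 0"
    and "\<exists>z. f z \<noteq> 0"
  shows "growth_order f = \<infinity>"
proof (rule ccontr)
  assume "growth_order f \<noteq> \<infinity>"
  note ode = assms(6) and holf = assms(5)
  have fg: "finite_growth f" by (rule finite_growthI[OF holf]) fact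
  have holA: "A holomorphic_on UNIV" and holB: "B holomorphic_on UNIV"
    and Btr: "\<nexists>p. \<forall>z. B z = poly p z" and Atr: "\<nexists>p. \<forall>z. A z = poly p z"
    using assms(1,2) by (auto simp: transcendental_entire_def)
  have holf': "deriv f holomorphic_on UNIV" by (intro holomorphic_deriv holf) auto
  have Anz: "\<exists>z. A z \<noteq> 0"
  proof (rule ccontr)
    assume "\<not> (\<exists>z. A z \<noteq> 0)"
    then have "\<forall>z. A z = poly 0 z" by simp
    with Atr show False by blast
  qed
  \<comment> \<open>A nonzero constant solution would force \<open>B = 0\<close>.\<close>
  have f'nz: "\<exists>z. deriv f z \<noteq> 0"
  proof (rule ccontr)
    assume "\<not> (\<exists>z. deriv f z \<noteq> 0)"
    then have d0: "deriv f = (\<lambda>_. 0)" by auto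
    have "(f has_field_derivative 0) (at z)" for z
      using holomorphic_derivI[OF holf open_UNIV, of z] d0 by simp
    then have "\<exists>c. \<forall>x. f x = c"
      using has_field_derivative_zero_constant[of UNIV f] by auto
    then obtain c where c: "\<And>z. f z = c" by blast
    then have "c \<noteq> 0" using assms(7) by auto
    then have "\<forall>z. B z = poly 0 z" using ode d0 c by simp
    with Btr show False by blast
  qed
  then obtain w1 where w1: "deriv f w1 \<noteq> 0" by blast
  obtain c where
    circ: "\<And>X. \<exists>r\<ge>X. \<forall>z. norm z = r \<longrightarrow> f z \<noteq> 0 \<and> norm (deriv f z) \<le> norm z ^ c * norm (f z)
        \<and> norm (deriv (deriv f) z) \<le> norm z ^ c * norm (f z)"
    and ray: "\<And>u v. u < v \<Longrightarrow> \<exists>\<theta> X. u < \<theta> \<and> \<theta> < v \<and> (\<forall>r\<ge>X. \<forall>z. z = of_real r * cis \<theta> \<longrightarrow>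
        f z \<noteq> 0 \<and> norm (deriv f z) \<le> norm z ^ c * norm (f z)
        \<and> norm (deriv (deriv f) z) \<le> norm z ^ c * norm (f z))"
    by (rule finite_growth_second_log_derivs[OF holf fg w1]) (rule that)
  obtain \<alpha> where \<alpha>: "\<alpha> > 0" "ereal \<alpha> < growth_order A"
    "(\<lambda>z. of_int (zorder A z) * norm z powr (- \<alpha>)) summable_on {z. z \<noteq> 0 \<and> A z = 0}"
    using zeros_convergence_exponentD[OF assms(3)] .
  have A0: "growth_order A > 0"
    using \<alpha>(1) by (intro less_trans[OF _ \<alpha>(2)]) simp
  have "lower_growth_order B \<le> growth_order A"
  proof (rule lower_growth_order_le_growth_order[OF holA holB A0])
    fix X
    show "\<exists>r\<ge>X. \<forall>z. norm z = r \<longrightarrow> norm (B z) \<le> norm z ^ c * (1 + norm (A z))"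
      using circ[of X] linear_ode_coefficient_bound[OF ode] by meson
  qed
  with assms(4) have "lower_growth_order B < growth_order A" by simp
  with A0 have "max (lower_growth_order B) 0 < growth_order A" by simp
  then obtain \<sigma> where \<sigma>: "max (lower_growth_order B) 0 < ereal \<sigma>" "ereal \<sigma> < growth_order A"
    using ereal_dense2 by blast
  have \<sigma>0: "\<sigma> \<ge> 0" using \<sigma>(1) by simp
  have far: "\<exists>r\<ge>X. \<forall>z. norm z = r \<longrightarrow> norm (B z) \<le> exp (r powr \<sigma>)" for X
    using \<sigma>(1) by (intro lower_growth_order_lessD[OF holB \<sigma>0]) simp
  obtain v g where vg: "v holomorphic_on UNIV" "g holomorphic_on UNIV" "\<And>z. A z = v z * exp (g z)"
    "growth_at_most \<alpha> v"
    by (rule zeros_convergence_factorization[OF holA Anz \<alpha>(1,3)]) (rule that)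
  \<comment> \<open>A centre for the quotient estimate: a point at which neither \<open>A\<close> nor \<open>f'\<close> vanishes.\<close>
  have "finite ({z \<in> cball 0 1. A z = 0} \<union> {z \<in> cball 0 1. deriv f z = 0})"
    using Anz f'nz by (intro finite_UnI entire_not_constant_zeros_finite[OF holA] entire_not_constant_zeros_finite[OF holf']) auto
  moreover have "infinite (cball (0::complex) 1)"
    using uncountable_cball[of 1 "0::complex"] countable_finite by auto
  ultimately obtain w where w: "A w \<noteq> 0" "deriv f w \<noteq> 0"
    using finite_subset[of "cball 0 1" "{z \<in> cball 0 1. A z = 0} \<union> {z \<in> cball 0 1. deriv f z = 0}"] by blast
  have vw: "v w \<noteq> 0" using w(1) vg(3)[of w] by auto
  have "\<exists>p. \<forall>z. g z = poly p z"
    by (rule coefficient_exponent_is_poly[OF holf holB _ fg vg(1) growth_at_most_imp_finite_growth[OF vg(4)] vg(2) vw w(2) far])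
       (use ode vg(3) in simp)
  then obtain p where p: "\<And>z. g z = poly p z" by blast
  have Ap: "A = (\<lambda>z. v z * exp (poly p z))" using vg(3) p by auto
  define n where "n = degree p"
  have "growth_at_most (max \<alpha> (real n)) A"
    unfolding Ap by (intro growth_at_most_mult growth_at_most_mono[OF vg(4)]
        growth_at_most_mono[OF growth_at_most_exp_poly]) (auto simp: n_def)
  then have ordA: "growth_order A \<le> ereal (max \<alpha> (real n))"
    using \<alpha>(1) by (intro growth_at_most_imp_growth_order_le[OF holA]) auto
  have "ereal \<alpha> < ereal (max \<alpha> (real n))" by (rule less_le_trans[OF \<alpha>(2) ordA])
  then have \<alpha>n: "\<alpha> < real n" unfolding less_ereal.simps(1) by simp
  have "ereal \<sigma> < ereal (max \<alpha> (real n))" by (rule less_le_trans[OF \<sigma>(2) ordA])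
  then have \<sigma>n: "\<sigma> < real n" unfolding less_ereal.simps(1) using \<alpha>n by simp
  have "\<exists>p. \<forall>z. B z = poly p z"
  proof (rule entire_bounded_on_good_rays_imp_poly[OF holB \<sigma>0 \<sigma>n far, of "Arg (lead_coeff p)" c])
    fix u t :: real
    assume ut: "u < t" and neg: "\<And>x. u < x \<Longrightarrow> x < t \<Longrightarrow> cos (Arg (lead_coeff p) + real n * x) < 0"
    obtain \<theta> X where \<theta>: "u < \<theta>" "\<theta> < t" "\<And>r z. r \<ge> X \<Longrightarrow> z = of_real r * cis \<theta> \<Longrightarrow>
        f z \<noteq> 0 \<and> norm (deriv f z) \<le> norm z ^ c * norm (f z)
        \<and> norm (deriv (deriv f) z) \<le> norm z ^ c * norm (f z)"
      using ray[OF ut] by blast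
    have "\<forall>\<^sub>F r in at_top. norm (v (of_real r * cis \<theta>) * exp (poly p (of_real r * cis \<theta>))) \<le> 1"
      using \<alpha>(1) \<alpha>n neg[OF \<theta>(1,2)] by (intro exp_poly_decay_on_ray[OF vg(4)]) (auto simp: n_def)
    then obtain Y where Y: "\<And>r. r \<ge> Y \<Longrightarrow> norm (A (of_real r * cis \<theta>)) \<le> 1"
      unfolding eventually_at_top_linorder Ap by blast
    obtain C0 where C0: "\<And>z. norm z \<le> max X Y \<Longrightarrow> norm (B z) \<le> C0"
      using entire_bounded_on_cball[OF holB, of "max X Y"] by blast
    have "norm (B (of_real r * cis \<theta>)) \<le> max 2 C0 * r ^ c" if r: "r \<ge> 1" for r
    proof (cases "r \<ge> max X Y")
      case True
      define z where "z = of_real r * cis \<theta>"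
      have nz: "norm z = r" using r by (simp add: z_def norm_mult)
      have "norm (B z) \<le> norm z ^ c * (1 + norm (A z))"
        using linear_ode_coefficient_bound[OF ode] \<theta>(3)[OF _ z_def] True by auto
      also have "\<dots> \<le> r ^ c * (1 + 1)"
        unfolding nz using Y[of r] True r by (intro mult_left_mono) (auto simp: z_def)
      also have "\<dots> \<le> max 2 C0 * r ^ c" using r by (simp add: mult.commute mult_right_mono)
      finally show ?thesis by (simp add: z_def)
    next
      case False
      then have "norm (B (of_real r * cis \<theta>)) \<le> C0"
        using r by (intro C0) (auto simp: norm_mult)
      also have "\<dots> \<le> max 2 C0 * 1" by simp
      also have "\<dots> \<le> max 2 C0 * r ^ c" using r by (intro mult_left_mono one_le_power) auto
      finally show ?thesis .
    qed
    then show "\<exists>\<theta> C. u < \<theta> \<and> \<theta> < t \<and> (\<forall>r\<ge>1. norm (B (of_real r * cis \<theta>)) \<le> C * r ^ c)"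
      using \<theta>(1,2) by blast
  qed
  with Btr show False by blast
qed

end
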